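(* Let $d=a+b+c$ with $a,b,c$ positive integers such that $b^2-4ac>0$. (A) Assume that $a\equiv1\bmod4$ and that either $b\equiv c\equiv0\bmod4$ or $b\equiv c\equiv1\bmod4$. Then $\lambda=\sqrt a+\sqrt c+i\sqrt{b-2\sqrt{ac}}$ is $d$-critical. (B) Assume that $a\equiv3\bmod4$ and that either $b\equiv c\equiv0\bmod4$ or $b\equiv c\equiv3\bmod4$. Then $\lambda=\sqrt{b-2\sqrt{ac}}+i\sqrt a+i\sqrt c$ is $d$-critical.
   Context: Let $d$ be an odd positive integer. A complex number $\lambda$ is $d$-critical (a $d$-critical value) if there exists a nonzero function $f:\mathbb Z/d\mathbb Z\to\mathbb C$ such that $\sum_{\ell\in\mathbb Z/d\mathbb Z}f(k+\ell)f(k-\ell)=\lambda f(k)^2$ for all $k\in\mathbb Z/d\mathbb Z$. *)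

theory Defs
  imports Complex_Main "HOL-Number_Theory.Number_Theory"
begin

text \<open>
  The ring \<open>\<int>/d\<int>\<close> is \<^term>\<open>residue_ring (int d)\<close>, with carrier \<open>{0..int d - 1}\<close>.
  A function on it is a function \<open>int \<Rightarrow> complex\<close> of which only the values on the carrier
  are used. Parity of \<open>d\<close> is not part of the definition.
\<close>

definition critical_value :: "nat \<Rightarrow> complex \<Rightarrow> bool" where
  "critical_value d z \<longleftrightarrow>
     (let R = residue_ring (int d) in
       \<exists>f :: int \<Rightarrow> complex. (\<exists>k\<in>carrier R. f k \<noteq> 0) \<and>
         (\<forall>k\<in>carrier R. (\<Sum>l\<in>carrier R. f (k \<oplus>\<^bsub>R\<^esub> l) * f (k \<ominus>\<^bsub>R\<^esub> l)) = z * (f k)\<^sup>2))"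

end

theory Submission
  imports Defs "HOL-Complex_Analysis.Complex_Analysis" "HOL-Real_Asymp.Real_Asymp"
begin

text \<open>
  The witness \<open>f\<close> is a theta function. For a complex binary quadratic form \<open>F\<close> with positive
  definite imaginary part let \<open>f(k)\<close> be the sum of \<open>exp (\<i>\<pi> F(m,n) / 4)\<close>, times a character of
  \<open>\<int>\<^sup>2\<close>, over the pairs \<open>(m,n)\<close> with \<open>n \<equiv> k (mod d)\<close>. By the parallelogram law
  \<open>2 (F(u) + F(v)) = F(u+v) + F(u-v)\<close>, a product \<open>f(x) f(y)\<close> becomes a sum over
  \<open>s = u + v\<close> and \<open>t = u - v\<close> in which \<open>s\<close> and \<open>t\<close> are linked only by their parities. Summing
  \<open>f(k+l) f(k-l)\<close> over \<open>l\<close> leaves \<open>t\<close> unrestricted, while \<open>f(k)\<^sup>2\<close> requires \<open>d\<close> to divide the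
  second component of \<open>t\<close>. So \<open>\<lambda>\<close> is critical as soon as, for each of the four parity classes
  of \<open>\<int>\<^sup>2\<close>, the sum of \<open>E(t) = exp (\<i>\<pi> F(t) / 8)\<close> over the class is \<open>\<lambda>\<close> times the sum over
  those \<open>t\<close> in the class with \<open>d | t\<^sub>2\<close> (\<open>lattice_criterion\<close>).

  Such an identity is a transformation law of a theta constant, at a point fixed by the
  transformation. In part (A) write \<open>\<lambda>\<lambda>' = \<delta>\<close> with \<open>\<lambda>'\<close> the complex conjugate of \<open>\<lambda>\<close>, and
  \<open>\<gamma> = \<surd>c\<close>, \<open>\<alpha> = \<surd>a\<close>, so that \<open>\<delta> = d\<close> and \<open>\<lambda> + \<lambda>' = 2 (\<alpha> + \<gamma>)\<close>; in part (B) take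
  \<open>\<lambda>'\<close> minus the conjugate, \<open>\<gamma> = \<i>\<surd>c\<close>, \<open>\<alpha> = \<i>\<surd>a\<close> and \<open>\<delta> = -d\<close>, which gives the same two
  relations. With \<open>g \<in> {0,1}\<close>, \<open>g \<equiv> \<gamma>\<^sup>2 (mod 4)\<close>, the form is
  \<open>F(m,n) = (1 - 1/\<lambda>\<^sup>2) n\<^sup>2 + 4 (g + \<gamma>/\<lambda>) m n + (g (1 - \<delta>) + \<gamma> (\<lambda> - \<lambda>')) m\<^sup>2\<close>.
  The pairs with \<open>d | t\<^sub>2\<close> are the pairs \<open>(m + 2y, \<delta> y)\<close>, and in the coordinates \<open>(m,y)\<close> the form
  becomes, up to a multiple of \<open>16 y\<^sup>2\<close>, the same form with \<open>1 - 1/\<lambda>\<^sup>2\<close> replaced by \<open>\<lambda>\<^sup>2 - 1\<close> and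
  \<open>\<gamma>/\<lambda>\<close> by \<open>\<gamma>\<lambda>\<close>: this is where \<open>\<lambda> + \<lambda>' = 2 (\<alpha> + \<gamma>)\<close> and the congruences enter. It then suffices
  to compare, for each fixed \<open>m\<close>, two theta series in one variable. Poisson summation
  turns both into dual series. Since \<open>1 / (1 - 1/\<lambda>\<^sup>2) = 1 + 1 / (\<lambda>\<^sup>2 - 1)\<close>, the exponents of
  corresponding terms differ only by multiples of \<open>2\<pi>\<i>\<close>, so the dual series agree, and the factors in
  front of them have quotient \<open>\<lambda>\<close> (\<open>theta_class_transfer\<close>).

  Two more facts are needed. Poisson summation for complex Gaussians (\<open>poisson_gauss\<close>) follows from the
  uniqueness, up to a factor, of an entire function with period 1 and a prescribed
  multiplier for a second period. And some choice of the character makes \<open>f\<close> nonzero, because averaging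
  over all characters of level \<open>N\<close> isolates the lattice \<open>N\<int>\<^sup>2\<close>, on which the term at the
  origin dominates (\<open>exists_nonvanishing_twist\<close>).
\<close>

section \<open>Gaussian series over the integers\<close>

lemma summable_exp_neg_abs: "(\<lambda>n::int. exp (- \<bar>real_of_int n\<bar>)) summable_on UNIV"
proof -
  have nat: "(\<lambda>n::nat. exp (- real n)) summable_on UNIV"
  proof (rule norm_summable_imp_summable_on)
    have "summable (\<lambda>n::nat. exp (-1::real) ^ n)"
      by (rule summable_geometric) simp
    then show "summable (\<lambda>n. norm (exp (- real n)))"
      by (simp flip: exp_of_nat_mult)
  qed
  have "(\<lambda>n::int. exp (- \<bar>real_of_int n\<bar>)) summable_on range int"
    by (subst summable_on_reindex) (use nat in \<open>simp_all add: o_def\<close>)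
  moreover have "(\<lambda>n::int. exp (- \<bar>real_of_int n\<bar>)) summable_on range (\<lambda>n. - int n)"
    by (subst summable_on_reindex) (use nat in \<open>simp_all add: o_def inj_on_def\<close>)
  moreover have "(UNIV::int set) = range int \<union> range (\<lambda>n. - int n)"
  proof (intro equalityI subsetI UNIV_I)
    fix n :: int
    show "n \<in> range int \<union> range (\<lambda>n. - int n)"
      by (cases n rule: int_cases2) auto
  qed
  ultimately show ?thesis
    by (metis summable_on_union)
qed

lemma summable_gauss:
  fixes a b :: real
  assumes "a > 0"
  shows "(\<lambda>n::int. exp (- a * (of_int n)\<^sup>2 + b * \<bar>of_int n\<bar>)) summable_on UNIV"
proof -
  \<comment> \<open>The maximum of \<open>-a x\<^sup>2 + (b + 1) x\<close>, attained at \<open>x = (b + 1)/(2a)\<close>.\<close>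
  define K where "K = (b + 1)\<^sup>2 / (4 * a)"
  have "(\<lambda>n::int. exp K * exp (- \<bar>real_of_int n\<bar>)) summable_on UNIV"
    by (intro summable_on_cmult_right summable_exp_neg_abs)
  then have "(\<lambda>n::int. norm (exp (- a * (of_int n)\<^sup>2 + b * \<bar>of_int n\<bar>))) summable_on UNIV"
  proof (rule Infinite_Sum.abs_summable_on_comparison_test')
    fix n :: int
    let ?x = "\<bar>real_of_int n\<bar>"
    have "0 \<le> (2 * a * ?x - (b + 1))\<^sup>2 / (4 * a)"
      using assms by simp
    also have "\<dots> = a * ?x\<^sup>2 - (b + 1) * ?x + K"
      using assms by (simp add: K_def power2_eq_square field_simps)
    finally have "- a * (of_int n)\<^sup>2 + b * ?x \<le> K - ?x"
      by (simp add: algebra_simps)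
    then show "norm (exp (- a * (of_int n)\<^sup>2 + b * ?x)) \<le> exp K * exp (- ?x)"
      by (simp flip: exp_add)
  qed
  then show ?thesis
    by (rule abs_summable_summable)
qed

definition theta_series :: "complex \<Rightarrow> complex \<Rightarrow> complex" where
  "theta_series A B = (\<Sum>\<^sub>\<infinity>n::int. exp (A * (of_int n)\<^sup>2 + B * of_int n))"

lemma norm_theta_term_le:
  assumes "Re A \<le> - a" and "norm B \<le> b"
  shows "norm (exp (A * (of_int n)\<^sup>2 + B * of_int n)) \<le> exp (- a * (of_int n)\<^sup>2 + b * \<bar>of_int n\<bar>)"
proof -
  have "Re (A * (of_int n)\<^sup>2) = Re A * (of_int n)\<^sup>2"
    by (simp add: power2_eq_square)
  also have "\<dots> \<le> - a * (of_int n)\<^sup>2"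
    using assms(1) by (intro mult_right_mono) auto
  finally have 1: "Re (A * (of_int n)\<^sup>2) \<le> - a * (of_int n)\<^sup>2" .
  have "Re (B * of_int n) \<le> norm (B * of_int n)"
    by (rule complex_Re_le_cmod)
  also have "\<dots> \<le> b * \<bar>of_int n\<bar>"
    using assms(2) by (simp add: norm_mult mult_right_mono)
  finally show ?thesis
    using 1 by simp
qed

lemma theta_term_abs_summable:
  assumes "Re A < 0"
  shows "(\<lambda>n::int. norm (exp (A * (of_int n)\<^sup>2 + B * of_int n))) summable_on UNIV"
proof (rule Infinite_Sum.abs_summable_on_comparison_test')
  show "(\<lambda>n::int. exp (- (- Re A) * (of_int n)\<^sup>2 + norm B * \<bar>of_int n\<bar>)) summable_on UNIV"
    using assms by (intro summable_gauss) auto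
  show "norm (exp (A * (of_int n)\<^sup>2 + B * of_int n)) \<le> exp (- (- Re A) * (of_int n)\<^sup>2 + norm B * \<bar>of_int n\<bar>)"
    for n :: int
    by (rule norm_theta_term_le) auto
qed

lemmas theta_term_summable = abs_summable_summable [OF theta_term_abs_summable]

text \<open>
  On a small closed disc \<open>Re A\<close> is bounded away from 0 and \<open>B\<close> is bounded, so one Gaussian
  majorises all terms and the Weierstrass test applies.
\<close>
lemma theta_series_holomorphic:
  assumes A: "A holomorphic_on S" and B: "B holomorphic_on S" and S: "open S"
    and neg: "\<And>z. z \<in> S \<Longrightarrow> Re (A z) < 0"
  shows "(\<lambda>z. theta_series (A z) (B z)) holomorphic_on S"
proof -
  have "(\<lambda>z. theta_series (A z) (B z)) field_differentiable at z" if z: "z \<in> S" for z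
  proof -
    obtain r where r: "r > 0" "cball z r \<subseteq> S"
      using open_contains_cball_eq[OF S] z by blast
    have ne: "cball z r \<noteq> {}" and cpt: "compact (cball z r)"
      using r by auto
    have cA: "continuous_on (cball z r) A" and cB: "continuous_on (cball z r) B"
      using A B by (auto intro: continuous_on_subset[OF _ r(2)] holomorphic_on_imp_continuous_on)
    have "continuous_on (cball z r) (\<lambda>w. Re (A w))" and "continuous_on (cball z r) (\<lambda>w. norm (B w))"
      using cA cB by (auto intro!: continuous_intros)
    from continuous_attains_sup[OF cpt ne this(1)] continuous_attains_sup[OF cpt ne this(2)]
    obtain x y where x: "x \<in> cball z r" "\<And>w. w \<in> cball z r \<Longrightarrow> Re (A w) \<le> Re (A x)"
      and y: "\<And>w. w \<in> cball z r \<Longrightarrow> norm (B w) \<le> norm (B y)"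
      by blast
    have "uniform_limit (cball z r) (\<lambda>X w. \<Sum>n\<in>X. exp (A w * (of_int n)\<^sup>2 + B w * of_int n))
            (\<lambda>w. \<Sum>\<^sub>\<infinity>n::int. exp (A w * (of_int n)\<^sup>2 + B w * of_int n)) (finite_subsets_at_top UNIV)"
    proof (rule Weierstrass_m_test_general)
      show "(\<lambda>n::int. exp (- (- Re (A x)) * (of_int n)\<^sup>2 + norm (B y) * \<bar>of_int n\<bar>)) summable_on UNIV"
        using neg[of x] x(1) r(2) by (intro summable_gauss) auto
      show "norm (exp (A w * (of_int n)\<^sup>2 + B w * of_int n))
              \<le> exp (- (- Re (A x)) * (of_int n)\<^sup>2 + norm (B y) * \<bar>of_int n\<bar>)"
        if "w \<in> cball z r" for n :: int and w
        using x y that by (intro norm_theta_term_le) auto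
    qed
    moreover have "\<forall>\<^sub>F X in finite_subsets_at_top UNIV.
        continuous_on (cball z r) (\<lambda>w. \<Sum>n\<in>X. exp (A w * (of_int n)\<^sup>2 + B w * of_int n)) \<and>
        (\<lambda>w. \<Sum>n\<in>X. exp (A w * (of_int n)\<^sup>2 + B w * of_int n)) holomorphic_on ball z r"
    proof (intro always_eventually allI conjI)
      fix X :: "int set"
      have b: "ball z r \<subseteq> S"
        using r(2) by auto
      show "continuous_on (cball z r) (\<lambda>w. \<Sum>n\<in>X. exp (A w * (of_int n)\<^sup>2 + B w * of_int n))"
        using cA cB by (intro continuous_intros)
      show "(\<lambda>w. \<Sum>n\<in>X. exp (A w * (of_int n)\<^sup>2 + B w * of_int n)) holomorphic_on ball z r"
        using holomorphic_on_subset[OF A b] holomorphic_on_subset[OF B b] by (intro holomorphic_intros)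
    qed
    ultimately have "(\<lambda>w. theta_series (A w) (B w)) holomorphic_on ball z r"
      unfolding theta_series_def
      by (elim holomorphic_uniform_limit[rotated]) auto
    then show ?thesis
      using r(1) by (meson centre_in_ball holomorphic_on_imp_differentiable_at open_ball)
  qed
  then show ?thesis
    by (simp add: field_differentiable_at_within holomorphic_on_def)
qed

section \<open>Fourier coefficients of entire periodic functions\<close>

text \<open>
  For an entire function of period 1 this is the constant Fourier coefficient, for every starting point \<open>w\<close>. The
  free starting point allows computing it at any height in the plane.
\<close>
definition mean_from :: "complex \<Rightarrow> (complex \<Rightarrow> complex) \<Rightarrow> complex" where
  "mean_from w h = contour_integral (linepath w (w + 1)) h"

lemma entire_integrable: 
  assumes "h holomorphic_on UNIV"
  shows "h contour_integrable_on linepath a b"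
  using assms by (meson contour_integrable_continuous_linepath continuous_on_subset holomorphic_on_imp_continuous_on top_greatest)

lemma mean_from_diff:
  assumes "f holomorphic_on UNIV" "h holomorphic_on UNIV"
  shows "mean_from w (\<lambda>u. f u - h u) = mean_from w f - mean_from w h"
  unfolding mean_from_def by (intro contour_integral_diff entire_integrable assms)

lemma mean_from_cmult:
  assumes "h holomorphic_on UNIV"
  shows "mean_from w (\<lambda>u. c * h u) = c * mean_from w h"
  unfolding mean_from_def by (intro contour_integral_lmul entire_integrable assms)

lemma mean_from_const [simp]: "mean_from w (\<lambda>u. c) = c"
  by (simp add: mean_from_def)

lemma mean_from_primitive:
  assumes "\<And>u. (F has_field_derivative h u) (at u)"
  shows "mean_from w h = F (w + 1) - F w"
  unfolding mean_from_def
  using contour_integral_unique[OF contour_integral_primitive[of UNIV F h "linepath w (w+1)"]] assms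
  by simp

text \<open>
  With a primitive \<open>F\<close> of \<open>h\<close>, the mean from \<open>w\<close> is \<open>F(w+1) - F(w)\<close>, whose derivative in \<open>w\<close>
  vanishes by periodicity. This replaces shifting a contour across a rectangle.
\<close>
lemma mean_from_indep:
  assumes h: "h holomorphic_on UNIV" and per: "\<And>u. h (u + 1) = h u"
  shows "mean_from w h = mean_from 0 h"
proof -
  obtain F where F: "\<And>u. (F has_field_derivative h u) (at u)"
    using holomorphic_convex_primitive'[of UNIV h] h by auto
  have "((\<lambda>u. F (u + 1) - F u) has_field_derivative 0) (at u within UNIV)" for u
  proof -
    have "((\<lambda>u. F (u + 1)) has_field_derivative h (u + 1)) (at u)"
      using F[of "u + 1"] by (simp add: DERIV_shift)
    from DERIV_diff[OF this F[of u]] show ?thesis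
      by (simp add: per)
  qed
  then obtain c where "\<And>u. F (u + 1) - F u = c"
    using has_field_derivative_zero_constant[of UNIV "\<lambda>u. F (u + 1) - F u"] by auto
  then show ?thesis
    using mean_from_primitive[OF F, of w] mean_from_primitive[OF F, of 0] by metis
qed

lemma mean_from_shift:
  assumes h: "h holomorphic_on UNIV" 
  shows "mean_from w (\<lambda>u. h (u + v)) = mean_from (w + v) h"
proof -
  obtain F where F: "\<And>u. (F has_field_derivative h u) (at u)"
    using holomorphic_convex_primitive'[of UNIV h] h by auto
  have "((\<lambda>u. F (u + v)) has_field_derivative h (u + v)) (at u)" for u
    using F[of "u + v"] by (simp add: DERIV_shift)
  from mean_from_primitive[OF this] mean_from_primitive[OF F] show ?thesis
    by (simp add: add_ac)
qed

lemma mean_from_bound: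
  assumes "h holomorphic_on UNIV" "0 \<le> K" "\<And>u. u \<in> closed_segment w (w + 1) \<Longrightarrow> norm (h u) \<le> K"
  shows "norm (mean_from w h) \<le> K"
  using contour_integral_bound_linepath[OF entire_integrable[OF assms(1), of w "w + 1"] assms(2,3)]
  by (simp add: mean_from_def)

text \<open>
  The character whose mean against \<open>h\<close> is the Fourier coefficient of \<open>h\<close> of index \<open>s\<close>.
\<close>
definition fchar :: "int \<Rightarrow> complex \<Rightarrow> complex" where
  "fchar s u = exp (- 2 * pi * \<i> * of_int s * u)"

lemma exp_two_pi_i_eq_1: "exp (2 * pi * \<i> * u) = 1 \<longleftrightarrow> u \<in> \<int>"
proof
  assume "exp (2 * pi * \<i> * u) = 1"
  then have e: "exp (2 * pi * \<i> * u) = exp 0" by simp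
  then obtain n :: int where n: "2 * pi * \<i> * u = 0 + (of_int (2 * n) * pi) * \<i>"
    unfolding exp_eq by auto
  then have "(2 * pi * \<i>) * (u - of_int n) = 0"
    by (simp add: algebra_simps)
  then show "u \<in> \<int>" by auto
next
  assume "u \<in> \<int>"
  then obtain n where "u = of_int n" by (auto elim: Ints_cases)
  then show "exp (2 * pi * \<i> * u) = 1"
    using exp_integer_2pi[of "of_int n"] by (simp add: mult_ac)
qed

lemma fchar_holomorphic [holomorphic_intros]: "fchar s holomorphic_on S"
  unfolding fchar_def by (intro holomorphic_intros)

lemma fchar_0 [simp]: "fchar 0 u = 1" 
  by (simp add: fchar_def)

lemma fchar_add: "fchar (s + t) u = fchar s u * fchar t u"
  by (simp add: fchar_def algebra_simps flip: exp_add)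

lemma fchar_shift: "fchar s (u + v) = fchar s u * fchar s v"
  by (simp add: fchar_def algebra_simps flip: exp_add)

lemma fchar_1 [simp]: "fchar s 1 = 1"
proof -
  have "of_int (- s) \<in> (\<int> :: complex set)" by (rule Ints_of_int)
  then show ?thesis
    using exp_two_pi_i_eq_1[of "of_int (- s)"] by (simp add: fchar_def mult_ac)
qed

lemma fchar_neq_0 [simp]: "fchar s u \<noteq> 0"
  by (simp add: fchar_def)

lemma norm_fchar: "norm (fchar s u) = exp (2 * pi * of_int s * Im u)"
  by (simp add: fchar_def)

lemma mean_fchar:
  assumes "s \<noteq> 0" shows "mean_from 0 (fchar s) = 0"
proof -
  define c where "c = - 2 * pi * \<i> * of_int s"
  have c: "c \<noteq> 0" using assms by (simp add: c_def)
  have "((\<lambda>u. fchar s u / c) has_field_derivative fchar s u) (at u)" for u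
    unfolding fchar_def c_def[symmetric]
    by (rule derivative_eq_intros refl | use c in simp)+
  from mean_from_primitive[OF this, of 0] show ?thesis
    using fchar_1[of s] unfolding fchar_def[abs_def] by simp
qed

lemma fchar_eq_1: "fchar (-1) u = 1 \<longleftrightarrow> u \<in> \<int>"
  using exp_two_pi_i_eq_1[of u] by (simp add: fchar_def)

lemma periodic_of_int:
  fixes h :: "complex \<Rightarrow> 'a"
  assumes "\<And>u. h (u + 1) = h u"
  shows "h (u + of_int n) = h u"
proof (induction n arbitrary: u rule: int_induct[where k = 0])
  case (step1 i)
  then show ?case using assms[of "u + of_int i"] by (simp add: add_ac)
next
  case (step2 i)
  then show ?case using assms[of "u + of_int i - 1"] by (simp add: algebra_simps)
qed simp

text \<open>
  The factor \<open>exp (2\<pi>\<i>u) - 1\<close> has simple zeros exactly at the integers, where \<open>D\<close> vanishes too, so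
  the quotient has only removable singularities.
\<close>
lemma divide_by_period_zero:
  assumes D: "D holomorphic_on UNIV" and per: "\<And>u. D (u + 1) = D u" and D0: "D 0 = 0"
  obtains g where "g holomorphic_on UNIV" "\<And>u. g (u + 1) = g u" "\<And>u. (fchar (-1) u - 1) * g u = D u"
proof
  define g where "g = (\<lambda>u. if u \<in> \<int> then deriv D 0 / (2 * pi * \<i>) else D u / (fchar (-1) u - 1))"
  have nz: "fchar (-1) u - 1 \<noteq> 0" if "u \<notin> \<int>" for u
    using that by (simp add: fchar_eq_1)
  show gper: "g (u + 1) = g u" for u
  proof -
    have "u + 1 \<in> \<int> \<longleftrightarrow> u \<in> \<int>"
      by (metis Ints_1 Ints_add Ints_diff add_diff_cancel_right')
    then show ?thesis
      by (simp add: g_def per fchar_shift)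
  qed
  show "(fchar (-1) u - 1) * g u = D u" for u
  proof (cases "u \<in> \<int>")
    case True
    then obtain n where "u = of_int n" by (auto elim: Ints_cases)
    then have "D u = 0"
      using periodic_of_int[of D 0 n, OF per] D0 by simp
    then show ?thesis
      using True fchar_eq_1 by simp
  next
    case False
    then show ?thesis using nz by (simp add: g_def)
  qed
  have off: "g holomorphic_on - \<int>"
  proof (rule holomorphic_transform)
    show "(\<lambda>u. D u / (fchar (-1) u - 1)) holomorphic_on - \<int>"
      using nz by (intro holomorphic_intros holomorphic_on_subset[OF D]) auto
  qed (simp add: g_def)
  have near0: "g holomorphic_on ball 0 1"
  proof (rule no_isolated_singularity')
    have int0: "u = 0" if "u \<in> \<int>" "norm u < 1" for u :: complex
      using that by (auto elim!: Ints_cases)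
    show "g holomorphic_on ball 0 1 - {0}"
      by (rule holomorphic_on_subset[OF off]) (use int0 in auto)
    have "(D has_field_derivative deriv D 0) (at 0)"
      using D by (simp add: holomorphic_derivI)
    then have 1: "((\<lambda>u. D u / u) \<longlongrightarrow> deriv D 0) (at 0)"
      by (simp add: has_field_derivative_iff D0)
    have "(fchar (-1) has_field_derivative 2 * pi * \<i>) (at 0)"
      unfolding fchar_def[abs_def] by (rule derivative_eq_intros refl | simp)+
    then have 2: "((\<lambda>u. (fchar (-1) u - 1) / u) \<longlongrightarrow> 2 * pi * \<i>) (at 0)"
      by (simp add: has_field_derivative_iff fchar_def)
    have "((\<lambda>u. (D u / u) / ((fchar (-1) u - 1) / u)) \<longlongrightarrow> deriv D 0 / (2 * pi * \<i>)) (at 0)"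
      by (rule tendsto_divide[OF 1 2]) simp
    moreover have "\<forall>\<^sub>F u in at 0. (D u / u) / ((fchar (-1) u - 1) / u) = g u"
    proof -
      have "\<forall>\<^sub>F u in at (0::complex). u \<in> ball 0 1 - {0}"
        by (intro eventually_at_in_open) auto
      then show ?thesis
        by eventually_elim (use int0 in \<open>auto simp: g_def\<close>)
    qed
    ultimately have "(g \<longlongrightarrow> g 0) (at 0)"
      by (simp add: g_def tendsto_cong)
    then show "(g \<longlongrightarrow> g z) (at z within ball 0 1)" if "z \<in> {0}" for z
      using that by (simp add: at_within_open[of 0 "ball 0 1"])
  qed auto
  have "g field_differentiable at u" for u
  proof (cases "u \<in> \<int>")
    case False
    moreover have "open (- (\<int> :: complex set))"
      using closed_Ints by blast
    ultimately show ?thesis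
      using off holomorphic_on_imp_differentiable_at by blast
  next
    case True
    then obtain n where u: "u = of_int n" by (auto elim: Ints_cases)
    have "g field_differentiable at 0"
      using near0 holomorphic_on_imp_differentiable_at[of g "ball 0 1" 0] by simp
    then obtain g' where "(g has_field_derivative g') (at (u + of_int (- n)))"
      by (auto simp: field_differentiable_def u)
    then have "((\<lambda>u. g (u + of_int (- n))) has_field_derivative g') (at u)"
      by (simp only: DERIV_shift)
    then show ?thesis
      unfolding periodic_of_int[of g, OF gper] by (auto simp: field_differentiable_def)
  qed
  then show "g holomorphic_on UNIV"
    by (simp add: holomorphic_on_def field_differentiable_at_within)
qed

text \<open>
  The coefficient may be computed along the segment at height \<open>-\<sigma>\<close>, where the exponential
  has modulus \<open>exp (-2\<pi>k)\<close>.
\<close>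
lemma fourier_decay:
  assumes g: "g holomorphic_on UNIV" and per: "\<And>u. g (u + 1) = g u" and \<sigma>: "\<sigma> = 1 \<or> \<sigma> = (-1::int)"
  obtains K where "\<And>k::nat. norm (mean_from 0 (\<lambda>u. g u * fchar (\<sigma> * int k) u)) \<le> K * exp (-1) ^ k"
proof -
  \<comment> \<open>The height at which \<open>fchar (\<sigma> k)\<close> decays for \<open>k \<ge> 0\<close>.\<close>
  define w where "w = - (\<i> * of_int \<sigma>)"
  have Im: "Im u = - of_int \<sigma>" if "u \<in> closed_segment w (w + 1)" for u
  proof -
    from that obtain t where "u = w + of_real t"
      by (auto simp: closed_segment_def scaleR_conv_of_real algebra_simps)
    then show ?thesis by (simp add: w_def)
  qed
  have "compact (g ` closed_segment w (w + 1))"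
    using g by (intro compact_continuous_image continuous_on_subset[OF holomorphic_on_imp_continuous_on]) auto
  then obtain K where K: "K > 0" "\<And>u. u \<in> closed_segment w (w + 1) \<Longrightarrow> norm (g u) \<le> K"
    by (metis compact_imp_bounded bounded_pos image_eqI)
  show ?thesis
  proof
    fix k :: nat
    let ?h = "\<lambda>u. g u * fchar (\<sigma> * int k) u"
    have h: "?h holomorphic_on UNIV"
      by (intro holomorphic_intros g)
    have "mean_from 0 ?h = mean_from w ?h"
      by (rule mean_from_indep[symmetric]) (simp_all add: h per fchar_shift)
    also have "norm \<dots> \<le> K * exp (-1) ^ k"
    proof (rule mean_from_bound[OF h])
      fix u assume u: "u \<in> closed_segment w (w + 1)"
      have "norm (fchar (\<sigma> * int k) u) = exp (- 2 * pi * real k)"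
        using \<sigma> Im[OF u] by (auto simp: norm_fchar)
      also have "\<dots> \<le> exp (- real k)"
      proof -
        have "1 \<le> 2 * pi" using pi_gt3 by simp
        then have "1 * real k \<le> 2 * pi * real k" by (intro mult_right_mono) auto
        then show ?thesis by simp
      qed
      also have "\<dots> = exp (-1) ^ k"
        by (simp flip: exp_of_nat_mult)
      finally show "norm (?h u) \<le> K * exp (-1) ^ k"
        using K(2)[OF u] K(1) by (simp add: norm_mult mult_mono)
    qed (use K in simp)
    finally show "norm (mean_from 0 ?h) \<le> K * exp (-1) ^ k" .
  qed
qed

lemma zero_if_le_geometric:
  fixes x :: complex
  assumes "\<And>k::nat. norm x \<le> K * exp (-1) ^ k"
  shows "x = 0"
proof -
  have "(\<lambda>k. K * exp (-1::real) ^ k) \<longlonglongrightarrow> K * 0"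
    by (intro tendsto_intros LIMSEQ_power_zero) simp
  then have "norm x \<le> 0"
    using assms by (intro LIMSEQ_le_const[of _ 0]) auto
  then show ?thesis by simp
qed

text \<open>
  Chernoff's argument. Write \<open>h(u+v) - h(v) = (exp (2\<pi>\<i>u) - 1) g(u)\<close>. The left side has Fourier
  coefficient \<open>-h(v)\<close> at index 0 and zero at every other index, so the coefficients of \<open>g\<close> are constant on each side of the
  jump from index \<open>-1\<close> to index \<open>0\<close>. They also decay, hence vanish, and so does the jump \<open>h(v)\<close>.
\<close>
lemma zero_if_fourier_zero:
  assumes h: "h holomorphic_on UNIV" and per: "\<And>u. h (u + 1) = h u"
    and zero: "\<And>s. mean_from 0 (\<lambda>u. h u * fchar s u) = 0"
  shows "h v = 0"
proof -
  have hv: "(\<lambda>u. h (u + v)) holomorphic_on UNIV"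
    using holomorphic_on_compose_gen[OF _ h, of "\<lambda>u. u + v" UNIV] 
    by (simp add: o_def holomorphic_intros)
  have zero_v: "mean_from 0 (\<lambda>u. h (u + v) * fchar s u) = 0" for s
  proof -
    have hs: "(\<lambda>u. h u * fchar s u) holomorphic_on UNIV"
      by (intro holomorphic_intros h)
    have "h (u + v) * fchar s u = fchar (- s) v * (h (u + v) * fchar s (u + v))" for u
      using fchar_add[of "-s" s v] by (simp add: fchar_shift)
    then have "(\<lambda>u. h (u + v) * fchar s u) = (\<lambda>u. fchar (- s) v * (h (u + v) * fchar s (u + v)))"
      by (rule ext)
    then have "mean_from 0 (\<lambda>u. h (u + v) * fchar s u)
        = mean_from 0 (\<lambda>u. fchar (- s) v * (h (u + v) * fchar s (u + v)))"
      by (rule arg_cong)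
    also have "\<dots> = fchar (- s) v * mean_from 0 (\<lambda>u. h (u + v) * fchar s (u + v))"
      by (intro mean_from_cmult holomorphic_intros hv)
         (auto simp: fchar_def[abs_def] intro!: holomorphic_intros)
    also have "mean_from 0 (\<lambda>u. h (u + v) * fchar s (u + v)) = mean_from 0 (\<lambda>u. h u * fchar s u)"
      using mean_from_shift[OF hs, of 0 v] mean_from_indep[OF hs, of v] by (simp add: per fchar_shift)
    finally show ?thesis by (simp add: zero)
  qed
  obtain g where g: "g holomorphic_on UNIV" and gper: "\<And>u. g (u + 1) = g u"
    and gD: "\<And>u. (fchar (-1) u - 1) * g u = h (u + v) - h v"
  proof (rule divide_by_period_zero)
    show "(\<lambda>u. h (u + v) - h v) holomorphic_on UNIV"
      by (intro holomorphic_intros hv)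
    show "h (u + 1 + v) - h v = h (u + v) - h v" for u
      using per[of "u + v"] by (simp add: add_ac)
  qed auto
  define c where "c s = mean_from 0 (\<lambda>u. g u * fchar s u)" for s
  have gs: "(\<lambda>u. g u * fchar s u) holomorphic_on UNIV" for s
    by (intro holomorphic_intros g)
  have diff: "c (s - 1) - c s = - h v * mean_from 0 (fchar s)" for s
  proof -
    have "c (s - 1) - c s = mean_from 0 (\<lambda>u. g u * fchar (s - 1) u - g u * fchar s u)"
      unfolding c_def by (intro mean_from_diff[symmetric] gs)
    also have "\<dots> = mean_from 0 (\<lambda>u. h (u + v) * fchar s u - h v * fchar s u)"
    proof -
      have "g u * fchar (s - 1) u - g u * fchar s u = h (u + v) * fchar s u - h v * fchar s u" for u
      proof -
        have e: "fchar (s - 1) u = fchar (-1) u * fchar s u"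
          using fchar_add[of "-1" s u] by simp
        have "g u * fchar (s - 1) u - g u * fchar s u = ((fchar (-1) u - 1) * g u) * fchar s u"
          unfolding e by (simp add: algebra_simps)
        then show ?thesis unfolding gD by (simp add: algebra_simps)
      qed
      then show ?thesis by simp
    qed
    also have "\<dots> = mean_from 0 (\<lambda>u. h (u + v) * fchar s u) - mean_from 0 (\<lambda>u. h v * fchar s u)"
      by (intro mean_from_diff holomorphic_intros hv)
    also have "\<dots> = - h v * mean_from 0 (fchar s)"
      by (simp add: zero_v mean_from_cmult fchar_holomorphic)
    finally show ?thesis .
  qed
  have up: "c (int k) = c 0" for k
  proof (induction k)
    case (Suc k)
    then show ?case using diff[of "int (Suc k)"] by (simp add: mean_fchar)
  qed simp
  have down: "c (- int k - 1) = c (-1)" for k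
  proof (induction k)
    case (Suc k)
    then show ?case using diff[of "- int k - 1"] by (simp add: mean_fchar algebra_simps)
  qed simp
  obtain K where K: "\<And>k::nat. norm (c (1 * int k)) \<le> K * exp (-1) ^ k"
    unfolding c_def by (rule fourier_decay[OF g gper, of 1]) auto
  have "c 0 = 0"
    using K up by (intro zero_if_le_geometric[of _ K]) simp
  obtain K' where K': "\<And>k::nat. norm (c (-1 * int k)) \<le> K' * exp (-1) ^ k"
    unfolding c_def by (rule fourier_decay[OF g gper, of "-1"]) auto
  have "c (-1) = 0"
  proof (rule zero_if_le_geometric)
    fix k :: nat
    have e: "-1 * int (Suc k) = - int k - 1" by simp
    show "norm (c (-1)) \<le> (K' * exp (-1)) * exp (-1) ^ k"
      using K'[of "Suc k"] unfolding e down by (simp add: mult_ac)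
  qed
  moreover have "mean_from 0 (fchar 0) = 1"
    by (simp add: fchar_def[abs_def])
  ultimately show ?thesis
    using diff[of 0] \<open>c 0 = 0\<close> by simp
qed

text \<open>
  The second period relates each Fourier coefficient to the next one by a nonzero factor, so
  the vanishing of the mean forces all of them to vanish.
\<close>
lemma quasi_periodic_zero:
  assumes h: "h holomorphic_on UNIV" and per: "\<And>u. h (u + 1) = h u"
    and qp: "\<And>u. h (u + \<omega>) = C * fchar 1 u * h u"
    and mean: "mean_from 0 h = 0" and "C \<noteq> 0"
  shows "h v = 0"
proof (rule zero_if_fourier_zero[OF h per])
  define c where "c s = mean_from 0 (\<lambda>u. h u * fchar s u)" for s
  have hs: "(\<lambda>u. h u * fchar s u) holomorphic_on UNIV" for s
    by (intro holomorphic_intros h)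
  have step: "c s = (C * fchar s \<omega>) * c (s + 1)" for s
  proof -
    have "c s = mean_from 0 (\<lambda>u. h (u + \<omega>) * fchar s (u + \<omega>))"
      unfolding c_def using mean_from_shift[OF hs, of 0 \<omega> s] mean_from_indep[OF hs, of s \<omega>]
      by (simp add: per fchar_shift)
    also have "\<dots> = mean_from 0 (\<lambda>u. (C * fchar s \<omega>) * (h u * fchar (s + 1) u))"
      by (simp add: qp fchar_shift fchar_add mult_ac)
    also have "\<dots> = (C * fchar s \<omega>) * c (s + 1)"
      unfolding c_def by (rule mean_from_cmult[OF hs])
    finally show ?thesis .
  qed
  have 0: "c 0 = 0"
    by (simp add: c_def mean)
  show "mean_from 0 (\<lambda>u. h u * fchar s u) = 0" for s
    unfolding c_def[symmetric]
  proof (induction s rule: int_induct[where k = 0])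
    case (step1 i)
    then show ?case using step[of i] \<open>C \<noteq> 0\<close> by simp
  next
    case (step2 i)
    then show ?case using step[of "i - 1"] by simp
  qed (rule 0)
qed

lemma quasi_periodic_proportional:
  assumes f: "f holomorphic_on UNIV" "\<And>u. f (u + 1) = f u" "\<And>u. f (u + \<omega>) = C * fchar 1 u * f u"
    and h: "h holomorphic_on UNIV" "\<And>u. h (u + 1) = h u" "\<And>u. h (u + \<omega>) = C * fchar 1 u * h u"
    and "C \<noteq> 0"
  shows "f u * h v = f v * h u"
proof -
  \<comment> \<open>The combination of mean zero.\<close>
  define D where "D w = mean_from 0 h * f w - mean_from 0 f * h w" for w
  have Dhol: "D holomorphic_on UNIV"
    unfolding D_def[abs_def] by (intro holomorphic_intros f h)
  have hm: "mean_from 0 h * f w = mean_from 0 f * h w" for w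
  proof -
    have "D w = 0"
    proof (rule quasi_periodic_zero[OF Dhol])
      show "D (u + 1) = D u" for u by (simp add: D_def f h)
      show "D (u + \<omega>) = C * fchar 1 u * D u" for u
        unfolding D_def f(3) h(3) by (simp add: algebra_simps)
      have "mean_from 0 D = mean_from 0 (\<lambda>w. mean_from 0 h * f w) - mean_from 0 (\<lambda>w. mean_from 0 f * h w)"
        unfolding D_def[abs_def] by (intro mean_from_diff holomorphic_intros f h)
      then show "mean_from 0 D = 0" by (simp add: mean_from_cmult f h)
    qed fact
    then show ?thesis by (simp add: D_def)
  qed
  show ?thesis
  proof (cases "mean_from 0 h = 0")
    case True
    then have "h w = 0" for w
      using quasi_periodic_zero[OF h] \<open>C \<noteq> 0\<close> by blast
    then show ?thesis by simp
  next
    case False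
    have "mean_from 0 h * (f u * h v) = mean_from 0 h * (f v * h u)"
      using hm[of u] hm[of v] by (metis mult.assoc mult.commute)
    then show ?thesis using False by simp
  qed
qed

section \<open>Poisson summation for Gaussians\<close>

text \<open>
  Poisson summation equates this with \<open>gauss_fourier \<alpha> u / csqrt \<alpha>\<close>.
\<close>
definition gauss_shift :: "complex \<Rightarrow> complex \<Rightarrow> complex" where
  "gauss_shift \<alpha> u = (\<Sum>\<^sub>\<infinity>n::int. exp (- pi * \<alpha> * (of_int n + u)\<^sup>2))" for \<alpha> u :: complex

definition gauss_fourier :: "complex \<Rightarrow> complex \<Rightarrow> complex" where
  "gauss_fourier \<alpha> u = (\<Sum>\<^sub>\<infinity>n::int. exp (- pi * (of_int n)\<^sup>2 / \<alpha> + 2 * pi * \<i> * of_int n * u))" for \<alpha> u :: complex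

lemma gauss_shift_theta:
  "gauss_shift \<alpha> u = exp (- pi * \<alpha> * u\<^sup>2) * theta_series (- pi * \<alpha>) (- 2 * pi * \<alpha> * u)" for \<alpha> u :: complex
  unfolding gauss_shift_def theta_series_def infsum_cmult_right'[symmetric]
  by (intro infsum_cong) (simp add: power2_eq_square algebra_simps flip: exp_add)

lemma gauss_fourier_theta:
  "gauss_fourier \<alpha> u = theta_series (- pi / \<alpha>) (2 * pi * \<i> * u)" for \<alpha> u :: complex
  unfolding gauss_fourier_def theta_series_def
  by (intro infsum_cong) (simp add: algebra_simps)

lemma Re_inverse_pos: "Re \<alpha> > 0 \<Longrightarrow> Re (1 / \<alpha>) > 0" for \<alpha> :: complex
  by (auto simp: Re_divide intro!: divide_pos_pos add_pos_nonneg)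

lemma Re_dual_neg: "Re \<alpha> > 0 \<Longrightarrow> Re (- pi / \<alpha>) < 0" for \<alpha> :: complex
proof -
  assume "Re \<alpha> > 0"
  moreover have "- pi / \<alpha> = - (of_real pi * (1 / \<alpha>))" by simp
  ultimately show ?thesis
    using Re_inverse_pos[of \<alpha>] by (simp only: uminus_complex.sel Re_complex_of_real times_complex.sel Im_complex_of_real) simp
qed

lemma gauss_shift_summable:
  fixes \<alpha> u :: complex
  assumes "Re \<alpha> > 0"
  shows "(\<lambda>n::int. exp (- pi * \<alpha> * (of_int n + u)\<^sup>2)) summable_on UNIV"
proof -
  have "(\<lambda>n::int. exp (- pi * \<alpha> * u\<^sup>2) * exp ((- pi * \<alpha>) * (of_int n)\<^sup>2 + (- 2 * pi * \<alpha> * u) * of_int n)) summable_on UNIV"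
    using assms by (intro summable_on_cmult_right theta_term_summable) simp
  then show ?thesis
    by (rule summable_on_cong[THEN iffD1, rotated])
       (simp add: power2_eq_square algebra_simps flip: exp_add)
qed

lemma gauss_fourier_summable:
  fixes \<alpha> u :: complex
  assumes "Re \<alpha> > 0"
  shows "(\<lambda>n::int. exp (- pi * (of_int n)\<^sup>2 / \<alpha> + 2 * pi * \<i> * of_int n * u)) summable_on UNIV"
  by (rule summable_on_cong[THEN iffD1, rotated,
        OF theta_term_summable[OF Re_dual_neg[OF assms], of "2 * pi * \<i> * u"]])
     (simp add: algebra_simps)

lemma gauss_shift_period: "gauss_shift \<alpha> (u + 1) = gauss_shift \<alpha> u" for \<alpha> u :: complex
  unfolding gauss_shift_def
  by (rule infsum_reindex_bij_witness[where j = "\<lambda>n. n + 1" and i = "\<lambda>n. n - 1"])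
     (simp_all add: algebra_simps)

lemma exp_2pi_int: "exp (2 * pi * \<i> * of_int n) = 1"
  by (subst exp_two_pi_i_eq_1) simp

lemma gauss_shift_quasi_period:
  fixes \<alpha> u :: complex
  assumes "\<alpha> \<noteq> 0"
  shows "gauss_shift \<alpha> (u + \<i> / \<alpha>) = exp (pi / \<alpha>) * fchar 1 u * gauss_shift \<alpha> u"
  unfolding gauss_shift_def infsum_cmult_right'[symmetric]
proof (rule infsum_cong)
  fix n :: int
  have "- pi * \<alpha> * (of_int n + (u + \<i> / \<alpha>))\<^sup>2
      = pi / \<alpha> + (- 2 * pi * \<i> * u) + - pi * \<alpha> * (of_int n + u)\<^sup>2 + 2 * pi * \<i> * of_int (- n)"
    using assms by (simp add: field_simps power2_eq_square)
  then show "exp (- pi * \<alpha> * (of_int n + (u + \<i> / \<alpha>))\<^sup>2)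
      = exp (pi / \<alpha>) * fchar 1 u * exp (- pi * \<alpha> * (of_int n + u)\<^sup>2)"
    by (simp only: exp_add exp_2pi_int fchar_def) simp
qed

lemma gauss_fourier_period: "gauss_fourier \<alpha> (u + 1) = gauss_fourier \<alpha> u" for \<alpha> u :: complex
  unfolding gauss_fourier_def
proof (rule infsum_cong)
  fix n :: int
  have "- pi * (of_int n)\<^sup>2 / \<alpha> + 2 * pi * \<i> * of_int n * (u + 1)
      = (- pi * (of_int n)\<^sup>2 / \<alpha> + 2 * pi * \<i> * of_int n * u) + 2 * pi * \<i> * of_int n"
    by (simp add: algebra_simps)
  then show "exp (- pi * (of_int n)\<^sup>2 / \<alpha> + 2 * pi * \<i> * of_int n * (u + 1))
      = exp (- pi * (of_int n)\<^sup>2 / \<alpha> + 2 * pi * \<i> * of_int n * u)"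
    by (simp only: exp_add exp_2pi_int) simp
qed

lemma gauss_fourier_quasi_period:
  fixes \<alpha> u :: complex
  assumes "\<alpha> \<noteq> 0"
  shows "gauss_fourier \<alpha> (u + \<i> / \<alpha>) = exp (pi / \<alpha>) * fchar 1 u * gauss_fourier \<alpha> u"
  unfolding gauss_fourier_def infsum_cmult_right'[symmetric]
proof (rule infsum_reindex_bij_witness[where j = "\<lambda>n. n + 1" and i = "\<lambda>n. n - 1"])
  fix n :: int
  have "- pi * (of_int n)\<^sup>2 / \<alpha> + 2 * pi * \<i> * of_int n * (u + \<i> / \<alpha>)
      = pi / \<alpha> + (- 2 * pi * \<i> * u) + (- pi * (of_int (n + 1))\<^sup>2 / \<alpha> + 2 * pi * \<i> * of_int (n + 1) * u)"
    using assms by (simp add: field_simps power2_eq_square)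
  then show "exp (pi / \<alpha>) * fchar 1 u * exp (- pi * (of_int (n + 1))\<^sup>2 / \<alpha> + 2 * pi * \<i> * of_int (n + 1) * u)
      = exp (- pi * (of_int n)\<^sup>2 / \<alpha> + 2 * pi * \<i> * of_int n * (u + \<i> / \<alpha>))"
    by (simp only: exp_add fchar_def) simp
qed auto

text \<open>
  Both functions have period 1 and the same multiplier for the second period \<open>\<i>/\<alpha>\<close>, which leaves only
  a constant factor to be determined.
\<close>
lemma gauss_proportional:
  fixes \<alpha> u :: complex
  assumes "Re \<alpha> > 0"
  shows "gauss_shift \<alpha> u * gauss_fourier \<alpha> v = gauss_shift \<alpha> v * gauss_fourier \<alpha> u"
proof (rule quasi_periodic_proportional[where \<omega> = "\<i> / \<alpha>" and C = "exp (pi / \<alpha>)"])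
  have "\<alpha> \<noteq> 0" using assms by auto
  then show "gauss_shift \<alpha> (u + \<i> / \<alpha>) = exp (pi / \<alpha>) * fchar 1 u * gauss_shift \<alpha> u"
    and "gauss_fourier \<alpha> (u + \<i> / \<alpha>) = exp (pi / \<alpha>) * fchar 1 u * gauss_fourier \<alpha> u" for u
    by (simp_all add: gauss_shift_quasi_period gauss_fourier_quasi_period)
  show "gauss_shift \<alpha> holomorphic_on UNIV"
    unfolding gauss_shift_theta[abs_def] using assms
    by (intro holomorphic_intros theta_series_holomorphic) auto
  show "gauss_fourier \<alpha> holomorphic_on UNIV"
    unfolding gauss_fourier_theta[abs_def] using Re_dual_neg[OF assms]
    by (intro holomorphic_intros theta_series_holomorphic) auto
qed (simp_all add: gauss_shift_period gauss_fourier_period)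

lemma sum_roots_of_unity:
  assumes "N > 0"
  shows "(\<Sum>j<N. exp (2 * pi * \<i> * of_int s * of_nat j / of_nat N)) = (if int N dvd s then of_nat N else 0)"
proof -
  define z where "z = exp (2 * pi * \<i> * (of_int s / of_nat N))"
  have "exp (2 * pi * \<i> * of_int s * of_nat j / of_nat N) = z ^ j" for j
    by (simp add: z_def mult_ac flip: exp_of_nat_mult)
  then have eq: "(\<Sum>j<N. exp (2 * pi * \<i> * of_int s * of_nat j / of_nat N)) = (\<Sum>j<N. z ^ j)"
    by simp
  have z1: "z = 1 \<longleftrightarrow> int N dvd s"
  proof
    assume "z = 1"
    then have "of_int s / of_nat N \<in> (\<int> :: complex set)"
      unfolding z_def by (simp only: exp_two_pi_i_eq_1)
    then obtain k where "of_int s / of_nat N = (of_int k :: complex)"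
      by (rule Ints_cases)
    then have "of_int s = (of_int (k * int N) :: complex)"
      using assms by (simp add: field_simps)
    then have "s = k * int N" by (simp only: of_int_eq_iff)
    then show "int N dvd s" by simp
  next
    assume "int N dvd s"
    then obtain k where "s = int N * k" ..
    then have "of_int s / of_nat N = (of_int k :: complex)" using assms by simp
    then show "z = 1" unfolding z_def by (simp only: exp_2pi_int)
  qed
  have zN: "z ^ N = 1"
  proof -
    have "z ^ N = exp (2 * pi * \<i> * of_int s)"
      using assms by (simp add: z_def flip: exp_of_nat_mult)
    then show ?thesis by (simp only: exp_2pi_int)
  qed
  show ?thesis
  proof (cases "z = 1")
    case True
    then show ?thesis unfolding eq using z1 by simp
  next
    case False
    then show ?thesis unfolding eq using z1 geometric_sum[of z N] zN by simp
  qed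
qed

lemma has_sum_finite_sum:
  fixes f :: "'a \<Rightarrow> 'b \<Rightarrow> 'c::topological_comm_monoid_add"
  assumes "\<And>j. j \<in> J \<Longrightarrow> (f j has_sum S j) A"
  shows "((\<lambda>x. \<Sum>j\<in>J. f j x) has_sum (\<Sum>j\<in>J. S j)) A"
  using assms
proof (induction J rule: infinite_finite_induct)
  case (insert j J)
  then show ?case by (simp add: has_sum_add)
qed simp_all

text \<open>
  Splitting the integers into residue classes modulo \<open>N\<close>. Together with the next lemma this
  determines how the factor in Poisson summation changes when \<open>\<alpha>\<close> is divided by a square, without
  evaluating a Gaussian integral.
\<close>
lemma gauss_shift_multiplication:
  fixes \<alpha> u :: complex
  assumes \<alpha>: "Re \<alpha> > 0" and N: "N > 0"
  shows "(\<Sum>j<N. gauss_shift \<alpha> ((u + of_nat j) / of_nat N)) = gauss_shift (\<alpha> / (of_nat N)\<^sup>2) u"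
proof -
  let ?f = "\<lambda>n::int. exp (- pi * (\<alpha> / (of_nat N)\<^sup>2) * (of_int n + u)\<^sup>2)"
  define B where "B j = {n. n mod int N = int j}" for j
  have pos: "Re (\<alpha> / (of_nat N)\<^sup>2) > 0"
  proof -
    have e: "(of_nat N)\<^sup>2 = (of_real ((real N)\<^sup>2) :: complex)" by simp
    show ?thesis
      unfolding e Re_divide_of_real using \<alpha> N by simp
  qed
  have part: "gauss_shift \<alpha> ((u + of_nat j) / of_nat N) = infsum ?f (B j)" if "j < N" for j
    unfolding gauss_shift_def
  proof (rule infsum_reindex_bij_witness[where j = "\<lambda>q. q * int N + int j" and i = "\<lambda>n. n div int N"])
    fix q :: int
    have "of_int q + (u + of_nat j) / of_nat N = (of_int (q * int N + int j) + u) / of_nat N"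
      using N by (simp add: field_simps)
    then show "?f (q * int N + int j) = exp (- pi * \<alpha> * (of_int q + (u + of_nat j) / of_nat N)\<^sup>2)"
      by (simp add: power_divide)
  next
    fix n assume "n \<in> B j"
    then show "n div int N * int N + int j = n"
      using div_mult_mod_eq[of n "int N"] by (simp add: B_def)
  qed (use that in \<open>auto simp: B_def\<close>)
  have "(\<Sum>j<N. infsum ?f (B j)) = infsum ?f (\<Union> (B ` {..<N}))"
  proof (rule sum_infsum)
    show "?f summable_on B j" for j
      by (rule summable_on_subset[OF gauss_shift_summable[OF pos]]) simp
  qed (auto simp: B_def)
  also have "\<Union> (B ` {..<N}) = UNIV"
  proof -
    have "n \<in> B (nat (n mod int N))" "nat (n mod int N) < N" for n
      using N by (simp_all add: B_def nat_less_iff)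
    then show ?thesis by blast
  qed
  finally show ?thesis
    using part by (simp add: gauss_shift_def[of "\<alpha> / (of_nat N)\<^sup>2"])
qed

lemma gauss_fourier_multiplication:
  fixes \<alpha> u :: complex
  assumes \<alpha>: "Re \<alpha> > 0" and N: "N > 0"
  shows "(\<Sum>j<N. gauss_fourier \<alpha> ((u + of_nat j) / of_nat N)) = of_nat N * gauss_fourier (\<alpha> / (of_nat N)\<^sup>2) u"
proof -
  let ?f = "\<lambda>v (n::int). exp (- pi * (of_int n)\<^sup>2 / \<alpha> + 2 * pi * \<i> * of_int n * v)"
  have "(\<Sum>j<N. gauss_fourier \<alpha> ((u + of_nat j) / of_nat N))
      = (\<Sum>\<^sub>\<infinity>n. \<Sum>j<N. ?f ((u + of_nat j) / of_nat N) n)"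
    unfolding gauss_fourier_def
    by (intro infsumI[symmetric] has_sum_finite_sum has_sum_infsum gauss_fourier_summable[OF \<alpha>])
  also have "\<dots> = (\<Sum>\<^sub>\<infinity>n. if int N dvd n then of_nat N * ?f (u / of_nat N) n else 0)"
  proof (rule infsum_cong)
    fix n :: int
    have "(\<Sum>j<N. ?f ((u + of_nat j) / of_nat N) n)
        = ?f (u / of_nat N) n * (\<Sum>j<N. exp (2 * pi * \<i> * of_int n * of_nat j / of_nat N))"
      unfolding sum_distrib_left
      by (rule sum.cong) (simp_all add: add_divide_distrib algebra_simps flip: exp_add)
    then show "(\<Sum>j<N. ?f ((u + of_nat j) / of_nat N) n)
        = (if int N dvd n then of_nat N * ?f (u / of_nat N) n else 0)"
      unfolding sum_roots_of_unity[OF N] by simp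
  qed
  also have "\<dots> = infsum (\<lambda>n. of_nat N * ?f (u / of_nat N) n) {n. int N dvd n}"
    by (rule infsum_cong_neutral) auto
  also have "\<dots> = (\<Sum>\<^sub>\<infinity>n. of_nat N * exp (- pi * (of_int n)\<^sup>2 / (\<alpha> / (of_nat N)\<^sup>2) + 2 * pi * \<i> * of_int n * u))"
    by (rule infsum_reindex_bij_witness[where i = "\<lambda>n. n * int N" and j = "\<lambda>n. n div int N"])
       (use N in \<open>auto simp: power_mult_distrib mult_ac elim!: dvdE\<close>)
  finally show ?thesis
    by (simp add: gauss_fourier_def infsum_cmult_right')
qed

lemma gauss_fourier_pos:
  assumes "a > 0"
  shows "gauss_fourier (of_real a) 0 \<noteq> 0"
proof -
  let ?f = "\<lambda>n::int. exp (- pi * (of_int n)\<^sup>2 / a)"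
  have eq: "exp (- pi * (of_int n)\<^sup>2 / complex_of_real a + 2 * pi * \<i> * of_int n * 0) = complex_of_real (?f n)" for n
    by (simp flip: exp_of_real)
  have s: "(\<lambda>n. complex_of_real (?f n)) summable_on UNIV"
  proof -
    have "Re (complex_of_real a) > 0" using assms by simp
    from gauss_fourier_summable[OF this, of 0] show ?thesis by (simp only: eq)
  qed
  then have s': "?f summable_on UNIV"
    using summable_on_Re[OF s] by simp
  have "0 < sum ?f {0}" by simp
  also have "\<dots> \<le> infsum ?f UNIV"
    by (rule finite_sum_le_infsum[OF s']) auto
  finally have "infsum ?f UNIV \<noteq> 0" by simp
  moreover have "gauss_fourier (of_real a) 0 = of_real (infsum ?f UNIV)"
    unfolding gauss_fourier_def eq by (rule infsumI, rule has_sum_of_real) (use s' in simp)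
  ultimately show ?thesis by simp
qed

lemma poisson_rescale:
  fixes \<alpha> \<kappa> :: complex
  assumes \<alpha>: "Re \<alpha> > 0" and N: "N > 0" and "\<And>u. gauss_shift \<alpha> u = \<kappa> * gauss_fourier \<alpha> u"
  shows "gauss_shift (\<alpha> / (of_nat N)\<^sup>2) u = (of_nat N * \<kappa>) * gauss_fourier (\<alpha> / (of_nat N)\<^sup>2) u"
  unfolding gauss_shift_multiplication[OF \<alpha> N, symmetric] assms(3) sum_distrib_left[symmetric]
    gauss_fourier_multiplication[OF \<alpha> N]
  by simp

lemma poisson_real_ratio:
  assumes "a > (0::real)"
  obtains \<kappa> where "\<And>u. gauss_shift (of_real a) u = \<kappa> * gauss_fourier (of_real a) u"
proof
  show "gauss_shift (of_real a) u
      = (gauss_shift (of_real a) 0 / gauss_fourier (of_real a) 0) * gauss_fourier (of_real a) u" for u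
    using gauss_proportional[of "of_real a" u 0] gauss_fourier_pos[OF assms] assms
    by (simp add: field_simps)
qed

text \<open>
  At \<open>\<alpha> = 1\<close> and \<open>u = 0\<close> both series are the same sum of positive terms, so the factor is 1.
\<close>
lemma poisson_1: "gauss_shift 1 u = gauss_fourier 1 u"
proof -
  have "gauss_shift 1 0 = gauss_fourier 1 0"
    unfolding gauss_shift_def gauss_fourier_def by (intro infsum_cong) simp
  moreover have "gauss_fourier 1 0 \<noteq> 0"
    using gauss_fourier_pos[of 1] by simp
  ultimately show ?thesis
    using gauss_proportional[of 1 u 0] by simp
qed

lemma poisson_square:
  assumes p: "p > 0" and q: "q > 0"
  shows "gauss_shift (of_real ((real p / real q)\<^sup>2)) u = gauss_fourier (of_real ((real p / real q)\<^sup>2)) u / of_real (real p / real q)"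
proof -
  obtain \<kappa> where \<kappa>: "\<And>u. gauss_shift (of_real ((real p)\<^sup>2)) u = \<kappa> * gauss_fourier (of_real ((real p)\<^sup>2)) u"
    using poisson_real_ratio[of "(real p)\<^sup>2"] p by auto
  have "gauss_shift 1 0 = of_nat p * \<kappa> * gauss_fourier 1 0"
    using poisson_rescale[of "of_real ((real p)\<^sup>2)" p \<kappa> 0, OF _ p \<kappa>] p by simp
  then have "of_nat p * \<kappa> = 1"
    using poisson_1[of 0] gauss_fourier_pos[of 1] by simp
  then have k: "\<kappa> = 1 / of_nat p" using p by (simp add: field_simps)
  have e: "of_real ((real p)\<^sup>2) / (of_nat q)\<^sup>2 = (of_real ((real p / real q)\<^sup>2) :: complex)"
    by (simp add: power_divide)
  show ?thesis
    using poisson_rescale[of "of_real ((real p)\<^sup>2)" q \<kappa> u, OF _ q \<kappa>] p q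
    unfolding e k by simp
qed

text \<open>
  The identity is known at squares of rationals, which accumulate at 1, and both sides are
  holomorphic in \<open>\<alpha>\<close> on the right half-plane.
\<close>
lemma poisson_gauss:
  fixes \<alpha> u :: complex
  assumes "Re \<alpha> > 0"
  shows "gauss_shift \<alpha> u = gauss_fourier \<alpha> u / csqrt \<alpha>"
proof -
  define S where "S = {z. Re z > 0}"
  define D where "D z = gauss_shift z u - gauss_fourier z u / csqrt z" for z
  \<comment> \<open>Squares of rationals converging to 1 but different from 1.\<close>
  define x where "x k = ((real (k + 2) / real (k + 1))\<^sup>2)" for k :: nat
  have S: "open S" "connected S"
    unfolding S_def by (auto simp: open_halfspace_Re_gt convex_halfspace_Re_gt intro: convex_connected)
  have nonpos: "z \<notin> \<real>\<^sub>\<le>\<^sub>0" and nz: "z \<noteq> 0" if "z \<in> S" for z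
    using that by (auto simp: S_def complex_nonpos_Reals_iff)
  have "D holomorphic_on S"
    unfolding D_def gauss_shift_theta gauss_fourier_theta
    using nz nonpos Re_dual_neg S
    by (intro holomorphic_intros theta_series_holomorphic) (auto simp: S_def)
  then have "D \<alpha> = 0"
  proof (rule analytic_continuation[where U = "range (\<lambda>k. complex_of_real (x k))" and \<xi> = 1])
    show "1 islimpt range (\<lambda>k. complex_of_real (x k))"
      unfolding islimpt_sequential
    proof (intro exI conjI allI)
      show "complex_of_real (x k) \<in> range (\<lambda>k. complex_of_real (x k)) - {1}" for k
      proof -
        have "1 < real (k + 2) / real (k + 1)" by simp
        then have "1 < x k" unfolding x_def by (rule one_less_power) simp
        then have "complex_of_real (x k) \<noteq> 1"
          by (metis less_irrefl of_real_1 of_real_eq_iff)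
        then show ?thesis by blast
      qed
      have "x \<longlonglongrightarrow> 1\<^sup>2"
        unfolding x_def by (intro tendsto_power) real_asymp
      then show "(\<lambda>k. complex_of_real (x k)) \<longlonglongrightarrow> 1"
        using tendsto_of_real[of x 1 sequentially, where 'a = complex] by simp
    qed
    show "range (\<lambda>k. complex_of_real (x k)) \<subseteq> S"
      by (auto simp: S_def x_def)
    show "D z = 0" if zx: "z \<in> range (\<lambda>k. complex_of_real (x k))" for z
    proof -
      obtain k where z: "z = of_real ((real (k + 2) / real (k + 1))\<^sup>2)"
        using zx unfolding x_def by blast
      have "csqrt z = of_real (real (k + 2) / real (k + 1))"
        unfolding z of_real_power by (rule csqrt_square) auto
      then show ?thesis
        unfolding D_def using poisson_square[of "k + 2" "k + 1" u] by (simp add: z)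
    qed
  qed (use S assms in \<open>auto simp: S_def\<close>)
  then show ?thesis by (simp add: D_def)
qed

section \<open>Theta series over a parity class\<close>

text \<open>
  Completing the square in \<open>A n\<^sup>2 + 4 b n\<close> with \<open>n = 2k + \<epsilon>\<close> gives a shifted Gaussian with
  \<open>\<alpha> = -\<i>A/2\<close> and shift \<open>\<epsilon>/2 + b/A\<close>; the sign character \<open>(-1)\<^sup>\<epsilon>\<^sup>s\<close> is what remains of the parity class.
\<close>
lemma poisson_class:
  fixes A b :: complex and \<epsilon> :: int
  assumes A: "Im A > 0"
  shows "(\<Sum>\<^sub>\<infinity>k::int. exp (\<i> * pi / 8 * (A * (of_int (2 * k + \<epsilon>))\<^sup>2 + 4 * b * of_int (2 * k + \<epsilon>))))
       = (\<Sum>\<^sub>\<infinity>s::int. exp (\<i> * pi * of_int (\<epsilon> * s)) * exp (- (\<i> * pi / (2 * A)) * (2 * of_int s - b)\<^sup>2))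
           / csqrt (- \<i> * A / 2)"
proof -
  define \<alpha> where "\<alpha> = - \<i> * A / 2"
  define u where "u = of_int \<epsilon> / 2 + b / A"
  define c where "c = exp (- (\<i> * pi * b\<^sup>2 / (2 * A)))"
  have A0: "A \<noteq> 0" using A by auto
  have \<alpha>: "Re \<alpha> > 0" using A by (simp add: \<alpha>_def)
  have 1: "exp (\<i> * pi / 8 * (A * (of_int (2 * k + \<epsilon>))\<^sup>2 + 4 * b * of_int (2 * k + \<epsilon>)))
      = c * exp (- pi * \<alpha> * (of_int k + u)\<^sup>2)" for k :: int
  proof -
    have "\<i> * pi / 8 * (A * (of_int (2 * k + \<epsilon>))\<^sup>2 + 4 * b * of_int (2 * k + \<epsilon>))
        = - (\<i> * pi * b\<^sup>2 / (2 * A)) + - pi * \<alpha> * (of_int k + u)\<^sup>2"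
      using A0 by (simp add: \<alpha>_def u_def field_simps power2_eq_square)
    then show ?thesis by (simp only: c_def exp_add)
  qed
  have 2: "c * exp (- pi * (of_int s)\<^sup>2 / \<alpha> + 2 * pi * \<i> * of_int s * u)
      = exp (\<i> * pi * of_int (\<epsilon> * s)) * exp (- (\<i> * pi / (2 * A)) * (2 * of_int s - b)\<^sup>2)" for s :: int
  proof -
    have inv: "x / \<alpha> = 2 * \<i> * x / A" for x
      using A0 by (simp add: \<alpha>_def field_simps)
    have "- (\<i> * pi * b\<^sup>2 / (2 * A)) + (- pi * (of_int s)\<^sup>2 / \<alpha> + 2 * pi * \<i> * of_int s * u)
        = \<i> * pi * of_int (\<epsilon> * s) + - (\<i> * pi / (2 * A)) * (2 * of_int s - b)\<^sup>2"
      unfolding inv using A0 by (simp add: u_def field_simps power2_eq_square)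
    then show ?thesis by (simp only: c_def flip: exp_add)
  qed
  have "(\<Sum>\<^sub>\<infinity>k::int. c * exp (- pi * \<alpha> * (of_int k + u)\<^sup>2)) = c * gauss_shift \<alpha> u"
    unfolding gauss_shift_def by (rule infsum_cmult_right')
  also have "\<dots> = c * gauss_fourier \<alpha> u / csqrt \<alpha>"
    by (simp add: poisson_gauss[OF \<alpha>])
  also have "c * gauss_fourier \<alpha> u = (\<Sum>\<^sub>\<infinity>s::int. c * exp (- pi * (of_int s)\<^sup>2 / \<alpha> + 2 * pi * \<i> * of_int s * u))"
    unfolding gauss_fourier_def by (rule infsum_cmult_right'[symmetric])
  finally show ?thesis
    unfolding 1 2 by (simp add: \<alpha>_def)
qed

text \<open>
  The principal root of a number in the right half-plane has argument in \<open>(-\<pi>/4, \<pi>/4)\<close>, so the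
  quotient of two such roots has positive real part and can be \<open>l\<close> but not \<open>-l\<close>. This fixes the
  sign of the critical value.
\<close>
lemma csqrt_divide_square:
  assumes z: "Re z > 0" and w: "Re (z / l\<^sup>2) > 0" and l: "Re l > 0"
  shows "csqrt (z / l\<^sup>2) = csqrt z / l"
proof -
  have sector: "\<bar>Im (csqrt x)\<bar> < Re (csqrt x)" if "Re x > 0" for x
  proof -
    have "Re ((csqrt x)\<^sup>2) > 0" using that by simp
    then have "(Im (csqrt x))\<^sup>2 < (Re (csqrt x))\<^sup>2" by (simp add: power2_eq_square)
    moreover have "Re (csqrt x) \<ge> 0" using csqrt_principal[of x] by auto
    ultimately show ?thesis
      by (metis power2_abs power2_less_imp_less)
  qed
  define s t where "s = csqrt z" and "t = csqrt (z / l\<^sup>2)"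
  have l0: "l \<noteq> 0" using l by auto
  have "s\<^sup>2 = (t * l)\<^sup>2"
    using l0 by (simp add: s_def t_def power_mult_distrib)
  then have "s = t * l \<or> s = - (t * l)"
    by (rule power2_eq_iff[THEN iffD1])
  moreover have "s \<noteq> - (t * l)"
  proof
    assume neg: "s = - (t * l)"
    have "Re s > \<bar>Im s\<bar>" "Re t > \<bar>Im t\<bar>"
      using sector z w by (simp_all add: s_def t_def)
    then have "\<bar>Im s\<bar> * \<bar>Im t\<bar> < Re s * Re t"
      by (intro mult_strict_mono') auto
    then have "Re s * Re t + Im s * Im t > 0"
      using abs_le_D2[of "Im s * Im t" "\<bar>Im s\<bar> * \<bar>Im t\<bar>"] by (simp add: abs_mult)
    also have "Re s * Re t + Im s * Im t = - (Re l * ((Re t)\<^sup>2 + (Im t)\<^sup>2))"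
      by (simp add: neg power2_eq_square algebra_simps)
    also have "\<dots> \<le> 0" using l by simp
    finally show False by simp
  qed
  ultimately show ?thesis
    using l0 by (simp add: s_def t_def)
qed

lemma Im_one_minus_inverse_square:
  assumes "Re l > 0" "Im l > 0"
  shows "Im (1 - 1 / l\<^sup>2) > 0"
proof -
  have "l \<noteq> 0" and "Im (l\<^sup>2) > 0" using assms by (auto simp: power2_eq_square)
  moreover have "Im (1 - 1 / l\<^sup>2) = Im (l\<^sup>2) / (norm (l\<^sup>2))\<^sup>2"
    by (simp add: Im_divide cmod_power2)
  ultimately show ?thesis by simp
qed

text \<open>
  After Poisson summation the exponents at \<open>s\<close> differ by \<open>\<i>\<pi>/2\<close> times the integer
  \<open>(2s - mg)\<^sup>2 - m\<^sup>2 C\<close>, which is divisible by 4 since \<open>g\<^sup>2 \<equiv> C (mod 4)\<close>; so the dual series coincide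
  and only the square roots in front contribute, with quotient \<open>l\<close>.
\<close>
lemma theta_class_transfer:
  fixes l \<gamma> :: complex and g m C \<epsilon> :: int
  assumes l: "Re l > 0" "Im l > 0" and \<gamma>: "\<gamma>\<^sup>2 = of_int C" and C: "4 dvd g\<^sup>2 - C"
  shows "(\<Sum>\<^sub>\<infinity>k::int. exp (\<i> * pi / 8 * ((1 - 1 / l\<^sup>2) * (of_int (2 * k + \<epsilon>))\<^sup>2
              + 4 * (of_int m * (of_int g + \<gamma> / l)) * of_int (2 * k + \<epsilon>))))
       = l * (\<Sum>\<^sub>\<infinity>k::int. exp (\<i> * pi / 8 * ((l\<^sup>2 - 1) * (of_int (2 * k + \<epsilon>))\<^sup>2
              + 4 * (of_int m * (of_int g + \<gamma> * l)) * of_int (2 * k + \<epsilon>))))"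
proof -
  have l0: "l \<noteq> 0" using l by auto
  have A2: "Im (l\<^sup>2 - 1) > 0" using l by (simp add: power2_eq_square)
  have A1: "Im (1 - 1 / l\<^sup>2) > 0" by (rule Im_one_minus_inverse_square[OF l])
  have w1: "l\<^sup>2 - 1 \<noteq> 0" using A2 by auto
  have root: "csqrt (- \<i> * (1 - 1 / l\<^sup>2) / 2) = csqrt (- \<i> * (l\<^sup>2 - 1) / 2) / l"
  proof -
    have e: "- \<i> * (1 - 1 / l\<^sup>2) / 2 = (- \<i> * (l\<^sup>2 - 1) / 2) / l\<^sup>2"
      using l0 by (simp add: field_simps)
    show ?thesis
      unfolding e
    proof (rule csqrt_divide_square[OF _ _ l(1)])
      show "Re (- \<i> * (l\<^sup>2 - 1) / 2) > 0" using A2 by simp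
      show "Re ((- \<i> * (l\<^sup>2 - 1) / 2) / l\<^sup>2) > 0"
        unfolding e[symmetric] using A1 by simp
    qed
  qed
  obtain r where r: "g\<^sup>2 - C = 4 * r" using C ..
  have terms: "exp (- (\<i> * pi / (2 * (1 - 1 / l\<^sup>2))) * (2 * of_int s - of_int m * (of_int g + \<gamma> / l))\<^sup>2)
      = exp (- (\<i> * pi / (2 * (l\<^sup>2 - 1))) * (2 * of_int s - of_int m * (of_int g + \<gamma> * l))\<^sup>2)" for s :: int
  proof -
    define N where "N = 2 * complex_of_int s - of_int m * of_int g"
    define M where "M = complex_of_int m"
    have x1: "2 * of_int s - of_int m * (of_int g + \<gamma> / l) = N - M * \<gamma> / l"
      and x2: "2 * of_int s - of_int m * (of_int g + \<gamma> * l) = N - M * \<gamma> * l"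
      by (simp_all add: N_def M_def algebra_simps)
    have y1: "1 - 1 / l\<^sup>2 = (l\<^sup>2 - 1) / l\<^sup>2" using l0 by (simp add: field_simps)
    have "(N - M * \<gamma> / l)\<^sup>2 / (1 - 1 / l\<^sup>2) = (l * N - M * \<gamma>)\<^sup>2 / (l\<^sup>2 - 1)"
      unfolding y1 using l0 w1 by (simp add: field_simps power2_eq_square)
    also have "(l * N - M * \<gamma>)\<^sup>2 = (N - M * \<gamma> * l)\<^sup>2 + (N\<^sup>2 - M\<^sup>2 * \<gamma>\<^sup>2) * (l\<^sup>2 - 1)"
      by (simp add: algebra_simps power2_eq_square)
    also have "\<dots> / (l\<^sup>2 - 1) = (N - M * \<gamma> * l)\<^sup>2 / (l\<^sup>2 - 1) + (N\<^sup>2 - M\<^sup>2 * \<gamma>\<^sup>2)"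
      using w1 by (simp add: add_divide_distrib)
    also have "N\<^sup>2 - M\<^sup>2 * \<gamma>\<^sup>2 = of_int ((2 * s - m * g)\<^sup>2 - m\<^sup>2 * C)"
      by (simp add: N_def M_def \<gamma>)
    also have "(2 * s - m * g)\<^sup>2 - m\<^sup>2 * C = 4 * (s\<^sup>2 - s * m * g + m\<^sup>2 * r)"
    proof -
      have "(2 * s - m * g)\<^sup>2 - m\<^sup>2 * C = 4 * (s\<^sup>2 - s * m * g) + m\<^sup>2 * (g\<^sup>2 - C)"
        by (simp add: algebra_simps power2_eq_square)
      then show ?thesis unfolding r by (simp add: algebra_simps)
    qed
    finally have q: "(N - M * \<gamma> / l)\<^sup>2 / (1 - 1 / l\<^sup>2)
      = (N - M * \<gamma> * l)\<^sup>2 / (l\<^sup>2 - 1) + of_int (4 * (s\<^sup>2 - s * m * g + m\<^sup>2 * r))" .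
    have "- (\<i> * pi / (2 * (1 - 1 / l\<^sup>2))) * (N - M * \<gamma> / l)\<^sup>2
        = - (\<i> * pi / 2) * ((N - M * \<gamma> / l)\<^sup>2 / (1 - 1 / l\<^sup>2))" by simp
    also have "\<dots> = - (\<i> * pi / (2 * (l\<^sup>2 - 1))) * (N - M * \<gamma> * l)\<^sup>2
        + 2 * pi * \<i> * of_int (- (s\<^sup>2 - s * m * g + m\<^sup>2 * r))"
      unfolding q by (simp add: algebra_simps)
    finally show ?thesis
      unfolding x1 x2 by (simp only: exp_add exp_2pi_int) simp
  qed
  show ?thesis
    unfolding poisson_class[OF A1] poisson_class[OF A2] terms root using l0 by simp
qed

section \<open>From a lattice identity to the convolution equation\<close>

lemma abs_summable_prod:
  fixes f :: "'a \<Rightarrow> complex" and h :: "'b \<Rightarrow> complex"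
  assumes "(\<lambda>x. norm (f x)) summable_on A" "(\<lambda>y. norm (h y)) summable_on B"
  shows "(\<lambda>(x, y). norm (f x * h y)) summable_on A \<times> B"
proof (rule summable_on_SigmaI[where g = "\<lambda>x. norm (f x) * (\<Sum>\<^sub>\<infinity>y\<in>B. norm (h y))"])
  show "((\<lambda>y. case (x, y) of (x, y) \<Rightarrow> norm (f x * h y)) has_sum norm (f x) * (\<Sum>\<^sub>\<infinity>y\<in>B. norm (h y))) B" for x
    using has_sum_cmult_right[OF has_sum_infsum[OF assms(2)], of "norm (f x)"] by (simp add: norm_mult)
  show "(\<lambda>x. norm (f x) * (\<Sum>\<^sub>\<infinity>y\<in>B. norm (h y))) summable_on A"
    by (intro summable_on_cmult_left assms)
qed auto

lemma infsum_prod: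
  fixes f :: "'a \<Rightarrow> complex" and h :: "'b \<Rightarrow> complex"
  assumes "(\<lambda>x. norm (f x)) summable_on A" "(\<lambda>y. norm (h y)) summable_on B"
  shows "infsum f A * infsum h B = (\<Sum>\<^sub>\<infinity>(x, y)\<in>A \<times> B. f x * h y)"
proof -
  have "(\<lambda>z. norm (case z of (x, y) \<Rightarrow> f x * h y)) summable_on A \<times> B"
    using abs_summable_prod[OF assms] by (simp add: case_prod_unfold)
  then have "(\<lambda>(x, y). f x * h y) summable_on A \<times> B"
    by (rule abs_summable_summable)
  from infsum_Sigma'_banach[OF this] show ?thesis
    by (simp add: infsum_cmult_left' infsum_cmult_right')
qed

definition same_parity :: "int \<times> int \<Rightarrow> int \<times> int \<Rightarrow> bool" where
  "same_parity s t \<longleftrightarrow> even (fst t - fst s) \<and> even (snd t - snd s)"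

lemma sum_diff_parity:
  "bij_betw (\<lambda>(u, v). (u + v, u - v)) UNIV {(s, t). same_parity s t}"
proof (rule bij_betw_byWitness[where f' = "\<lambda>(s, t). (((fst s + fst t) div 2, (snd s + snd t) div 2), ((fst s - fst t) div 2, (snd s - snd t) div 2))"])
  show "\<forall>w\<in>{(s, t). same_parity s t}.
      (\<lambda>(u, v). (u + v, u - v)) (case w of (s, t) \<Rightarrow> (((fst s + fst t) div 2, (snd s + snd t) div 2), ((fst s - fst t) div 2, (snd s - snd t) div 2))) = w"
    by (auto simp: same_parity_def elim!: evenE) presburger+
qed (auto simp: same_parity_def)

text \<open>
  The substitution \<open>s = u + v\<close>, \<open>t = u - v\<close> maps onto the pairs of equal parity; this is the
  only link left between the two variables.
\<close>
lemma theta_addition: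
  fixes h P E :: "int \<times> int \<Rightarrow> complex"
  assumes sum: "(\<lambda>u. norm (h u)) summable_on UNIV"
    and prod: "\<And>u v. h u * h v = P (u + v) * E (u - v)"
  shows "(\<Sum>\<^sub>\<infinity>(u, v)\<in>{(u, v). u + v \<in> S \<and> u - v \<in> T}. h u * h v)
       = (\<Sum>\<^sub>\<infinity>s\<in>S. P s * (\<Sum>\<^sub>\<infinity>t\<in>{t \<in> T. same_parity s t}. E t))"
proof -
  define W where "W = {(u, v). u + v \<in> S \<and> u - v \<in> T}"
  define Z where "Z = Sigma S (\<lambda>s. {t \<in> T. same_parity s t})"
  have bij: "bij_betw (\<lambda>(u, v). (u + v, u - v)) W Z"
  proof -
    have "(\<lambda>(u, v). (u + v, u - v)) ` W = Z"
    proof (intro equalityI subsetI)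
      fix z assume z: "z \<in> Z"
      then have "z \<in> (\<lambda>(u, v). (u + v, u - v)) ` UNIV"
        using sum_diff_parity by (auto simp: Z_def bij_betw_def)
      then obtain u v where "z = (u + v, u - v)" by auto
      then show "z \<in> (\<lambda>(u, v). (u + v, u - v)) ` W"
        using z by (auto simp: W_def Z_def intro!: image_eqI[of _ _ "(u, v)"])
    qed (auto simp: W_def Z_def same_parity_def)
    moreover have "inj_on (\<lambda>(u, v). (u + v, u - v)) W"
      using sum_diff_parity inj_on_subset unfolding bij_betw_def by blast
    ultimately show ?thesis by (simp add: bij_betw_def)
  qed
  have "(\<lambda>(u, v). norm (h u * h v)) summable_on UNIV \<times> UNIV"
    by (rule abs_summable_prod[OF sum sum])
  then have "(\<lambda>(u, v). h u * h v) summable_on UNIV \<times> UNIV"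
    by (simp add: abs_summable_summable case_prod_unfold)
  then have sW: "(\<lambda>(u, v). h u * h v) summable_on W"
    by (rule summable_on_subset) auto
  have e: "(\<lambda>(u, v). h u * h v) = (\<lambda>w. (\<lambda>(s, t). P s * E t) ((\<lambda>(u, v). (u + v, u - v)) w))"
    by (auto simp: prod)
  have sm: "(\<lambda>(s, t). P s * E t) summable_on Z"
    using sW unfolding e by (rule summable_on_reindex_bij_betw[OF bij, THEN iffD1])
  have "(\<Sum>\<^sub>\<infinity>(u, v)\<in>W. h u * h v) = (\<Sum>\<^sub>\<infinity>(s, t)\<in>Z. P s * E t)"
    unfolding e by (rule infsum_reindex_bij_betw[OF bij])
  also have "\<dots> = (\<Sum>\<^sub>\<infinity>s\<in>S. \<Sum>\<^sub>\<infinity>t\<in>{t \<in> T. same_parity s t}. P s * E t)"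
    unfolding Z_def by (rule infsum_Sigma'_banach[symmetric]) (use sm in \<open>simp add: Z_def\<close>)
  finally show ?thesis
    by (simp add: infsum_cmult_right' W_def)
qed

text \<open>
  Summation over \<open>j\<close> removes every condition on \<open>u - v\<close> but its parity, while \<open>f(k)\<^sup>2\<close> forces \<open>d\<close> to divide its second
  component. Both sides are otherwise the same sum over \<open>u + v\<close>; oddness of \<open>d\<close> lets
  \<open>2 x \<equiv> 2 k\<close> be cancelled.
\<close>
lemma lattice_criterion:
  fixes h P E :: "int \<times> int \<Rightarrow> complex" and d :: int
  assumes d: "d > 0" "odd d"
    and sum: "(\<lambda>u. norm (h u)) summable_on UNIV"
    and prod: "\<And>u v. h u * h v = P (u + v) * E (u - v)"
    and E: "\<And>s. infsum E {t. same_parity s t} = l * infsum E {t. d dvd snd t \<and> same_parity s t}"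
  defines "f \<equiv> \<lambda>k. infsum h {u. d dvd (snd u - k)}"
  shows "(\<Sum>j\<in>{0..d - 1}. f (k + j) * f (k - j)) = l * (f k)\<^sup>2"
proof -
  define C where "C k = {u :: int \<times> int. d dvd (snd u - k)}" for k
  define S where "S = {s :: int \<times> int. d dvd (snd s - 2 * k)}"
  have sC: "(\<lambda>u. norm (h u)) summable_on A" for A
    by (rule summable_on_subset[OF sum]) simp
  have ff: "f x * f y = (\<Sum>\<^sub>\<infinity>(u, v)\<in>C x \<times> C y. h u * h v)" for x y
    unfolding f_def C_def by (rule infsum_prod[OF sC sC])
  have cancel: "d dvd x" if "d dvd 2 * x" for x
    using that d(2) by (metis coprime_commute coprime_dvd_mult_right_iff coprime_right_2_iff_odd)
  have "(\<lambda>(u, v). norm (h u * h v)) summable_on UNIV \<times> UNIV"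
    by (rule abs_summable_prod[OF sum sum])
  then have "(\<lambda>(u, v). h u * h v) summable_on UNIV \<times> UNIV"
    by (simp add: abs_summable_summable case_prod_unfold)
  then have sm: "(\<lambda>(u, v). h u * h v) summable_on A" for A
    by (rule summable_on_subset) auto
  have "(\<Sum>j\<in>{0..d - 1}. f (k + j) * f (k - j))
      = (\<Sum>\<^sub>\<infinity>(u, v)\<in>(\<Union>j\<in>{0..d - 1}. C (k + j) \<times> C (k - j)). h u * h v)"
    unfolding ff
  proof (rule sum_infsum)
    fix i j assume ij: "i \<in> {0..d - 1}" "j \<in> {0..d - 1}" "i \<noteq> j"
    have "\<not> d dvd (i - j)"
    proof
      assume "d dvd (i - j)"
      then have "\<bar>d\<bar> \<le> \<bar>i - j\<bar>" using ij by (intro dvd_imp_le_int) auto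
      then show False using ij by auto
    qed
    show "C (k + i) \<times> C (k - i) \<inter> C (k + j) \<times> C (k - j) = {}"
    proof (rule ccontr)
      assume "C (k + i) \<times> C (k - i) \<inter> C (k + j) \<times> C (k - j) \<noteq> {}"
      then obtain u :: "int \<times> int" where "d dvd (snd u - (k + j))" "d dvd (snd u - (k + i))"
        by (auto simp: C_def)
      then have "d dvd (snd u - (k + j)) - (snd u - (k + i))" by (rule dvd_diff)
      then show False using \<open>\<not> d dvd (i - j)\<close> by simp
    qed
  qed (auto intro: sm)
  also have "(\<Union>j\<in>{0..d - 1}. C (k + j) \<times> C (k - j)) = {(u, v). u + v \<in> S \<and> u - v \<in> UNIV}"
  proof (intro equalityI subsetI)
    fix w assume "w \<in> {(u, v). u + v \<in> S \<and> u - v \<in> UNIV}"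
    then obtain u v where w: "w = (u, v)" and uv: "d dvd (snd u + snd v - 2 * k)"
      by (auto simp: S_def)
    define j where "j = (snd u - k) mod d"
    have j: "j \<in> {0..d - 1}" using d by (simp add: j_def)
    have 1: "d dvd (snd u - (k + j))"
    proof -
      have "snd u - (k + j) = d * ((snd u - k) div d)"
        using minus_mod_eq_mult_div[of "snd u - k" d] by (simp add: j_def)
      then show ?thesis by simp
    qed
    have "snd v - (k - j) = (snd u + snd v - 2 * k) - (snd u - (k + j))" by simp
    then have "d dvd (snd v - (k - j))" using 1 uv by (metis dvd_diff)
    then show "w \<in> (\<Union>j\<in>{0..d - 1}. C (k + j) \<times> C (k - j))"
      using j 1 by (auto simp: w C_def)
  next
    fix w assume "w \<in> (\<Union>j\<in>{0..d - 1}. C (k + j) \<times> C (k - j))"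
    then obtain u v j where w: "w = (u, v)" and "d dvd (snd u - (k + j))" "d dvd (snd v - (k - j))"
      by (auto simp: C_def)
    then have "d dvd ((snd u - (k + j)) + (snd v - (k - j)))" by (intro dvd_add)
    then show "w \<in> {(u, v). u + v \<in> S \<and> u - v \<in> UNIV}"
      by (simp add: w S_def algebra_simps)
  qed
  also have "(\<Sum>\<^sub>\<infinity>(u, v)\<in>\<dots>. h u * h v) = (\<Sum>\<^sub>\<infinity>s\<in>S. P s * (\<Sum>\<^sub>\<infinity>t\<in>{t \<in> UNIV. same_parity s t}. E t))"
    by (rule theta_addition[OF sum prod])
  also have "\<dots> = (\<Sum>\<^sub>\<infinity>s\<in>S. l * (P s * (\<Sum>\<^sub>\<infinity>t\<in>{t \<in> {t. d dvd snd t}. same_parity s t}. E t)))"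
    by (simp add: E mult_ac)
  also have "\<dots> = l * (\<Sum>\<^sub>\<infinity>s\<in>S. P s * (\<Sum>\<^sub>\<infinity>t\<in>{t \<in> {t. d dvd snd t}. same_parity s t}. E t))"
    by (rule infsum_cmult_right')
  also have "(\<Sum>\<^sub>\<infinity>s\<in>S. P s * (\<Sum>\<^sub>\<infinity>t\<in>{t \<in> {t. d dvd snd t}. same_parity s t}. E t))
      = (\<Sum>\<^sub>\<infinity>(u, v)\<in>{(u, v). u + v \<in> S \<and> u - v \<in> {t. d dvd snd t}}. h u * h v)"
    by (rule theta_addition[OF sum prod, symmetric])
  also have "{(u, v). u + v \<in> S \<and> u - v \<in> {t. d dvd snd t}} = C k \<times> C k"
  proof -
    have "d dvd x + y - 2 * k \<and> d dvd x - y \<longleftrightarrow> d dvd x - k \<and> d dvd y - k" for x y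
    proof
      assume a: "d dvd x + y - 2 * k \<and> d dvd x - y"
      have "2 * (x - k) = (x + y - 2 * k) + (x - y)" "2 * (y - k) = (x + y - 2 * k) - (x - y)" by simp_all
      then show "d dvd x - k \<and> d dvd y - k"
        using a by (metis cancel dvd_add dvd_diff)
    next
      assume a: "d dvd x - k \<and> d dvd y - k"
      have "x + y - 2 * k = (x - k) + (y - k)" "x - y = (x - k) - (y - k)" by simp_all
      then show "d dvd x + y - 2 * k \<and> d dvd x - y"
        using a by (metis dvd_add dvd_diff)
    qed
    then show ?thesis by (auto simp: S_def C_def)
  qed
  finally show ?thesis
    by (simp add: ff power2_eq_square)
qed

section \<open>Nonvanishing of a character twist\<close>

lemma summable_tail_small:
  fixes F :: "'a \<Rightarrow> complex"
  assumes F: "(\<lambda>u. norm (F u)) summable_on UNIV" and "e > 0"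
  obtains X where "finite X" "\<And>Y. Y \<inter> X = {} \<Longrightarrow> norm (infsum F Y) < e"
proof -
  let ?n = "\<lambda>u. norm (F u)"
  have sub: "?n summable_on A" for A
    by (rule summable_on_subset[OF F]) simp
  obtain X where X: "finite X" "dist (sum ?n X) (infsum ?n UNIV) \<le> e / 2"
    using infsum_finite_approximation[OF F, of "e / 2"] \<open>e > 0\<close> by auto
  show ?thesis
  proof (rule that[OF X(1)])
    fix Y :: "'a set" assume Y: "Y \<inter> X = {}"
    have "norm (infsum F Y) \<le> infsum ?n Y"
      by (rule norm_infsum_bound[OF sub])
    also have "infsum ?n (Y \<union> X) = infsum ?n Y + infsum ?n X"
      by (rule infsum_Un_disjoint[OF sub sub Y])
    then have "infsum ?n Y = infsum ?n (Y \<union> X) - sum ?n X"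
      using X(1) by simp
    also have "infsum ?n (Y \<union> X) \<le> infsum ?n UNIV"
      by (rule infsum_mono_neutral[OF sub F]) auto
    also have "infsum ?n UNIV - sum ?n X \<le> e / 2"
      using X(2) unfolding dist_real_def by linarith
    also have "\<dots> < e" using \<open>e > 0\<close> by simp
    finally show "norm (infsum F Y) < e" by simp
  qed
qed

definition root_char :: "nat \<Rightarrow> nat \<Rightarrow> nat \<Rightarrow> int \<times> int \<Rightarrow> complex" where
  "root_char N i j u = exp (2 * pi * \<i> * of_int (fst u) * of_nat i / of_nat N)
      * exp (2 * pi * \<i> * of_int (snd u) * of_nat j / of_nat N)"

lemma norm_root_char [simp]: "norm (root_char N i j u) = 1"
proof -
  have "norm (exp (2 * pi * \<i> * of_int n * of_nat k / of_nat N)) = 1" for n :: int and k :: nat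
  proof -
    have "2 * pi * \<i> * of_int n * of_nat k / of_nat N = \<i> * of_real (2 * pi * of_int n * of_nat k / of_nat N)"
      by simp
    then show ?thesis by (simp only: norm_exp_i_times)
  qed
  then show ?thesis by (simp add: root_char_def norm_mult)
qed

lemma root_char_add: "root_char N i j (u + v) = root_char N i j u * root_char N i j v"
  by (simp add: root_char_def algebra_simps add_divide_distrib flip: exp_add)

text \<open>
  If all twisted sums vanished, so would their average over the characters of level \<open>N\<close>, which is the sum
  of \<open>F\<close> over the points of \<open>D\<close> divisible by \<open>N\<close>. For large \<open>N\<close> all of these except the origin lie in the tail of
  the series.
\<close>
lemma exists_nonvanishing_twist:
  fixes F :: "int \<times> int \<Rightarrow> complex"
  assumes F: "(\<lambda>u. norm (F u)) summable_on UNIV" and D: "0 \<in> D" and F0: "F 0 \<noteq> 0"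
  obtains N i j where "infsum (\<lambda>u. F u * root_char N i j u) D \<noteq> 0"
proof (rule ccontr)
  assume "\<not> thesis"
  then have zero: "infsum (\<lambda>u. F u * root_char N i j u) D = 0" for N i j
    using that by blast
  obtain X where X: "finite X" "\<And>Y. Y \<inter> X = {} \<Longrightarrow> norm (infsum F Y) < norm (F 0)"
    using summable_tail_small[OF F, of "norm (F 0)"] F0 by auto
  \<comment> \<open>Larger than every coordinate occurring in \<open>X\<close>.\<close>
  define N where "N = nat (Max (insert 0 ((\<lambda>u. \<bar>fst u\<bar> + \<bar>snd u\<bar>) ` X))) + 1"
  have N: "N > 0" by (simp add: N_def)
  have N_bound: "\<bar>fst u\<bar> + \<bar>snd u\<bar> < int N" if "u \<in> X" for u
  proof -
    have "\<bar>fst u\<bar> + \<bar>snd u\<bar> \<le> Max (insert 0 ((\<lambda>u. \<bar>fst u\<bar> + \<bar>snd u\<bar>) ` X))"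
      by (rule Max_ge) (use X(1) that in auto)
    moreover have "0 \<le> Max (insert 0 ((\<lambda>u. \<bar>fst u\<bar> + \<bar>snd u\<bar>) ` X))"
      by (rule Max_ge) (use X(1) in auto)
    ultimately show ?thesis unfolding N_def by linarith
  qed
  define L where "L = {u \<in> D. int N dvd fst u \<and> int N dvd snd u}"
  have L0: "L = insert 0 (L - {0})" using D by (auto simp: L_def)
  have "(L - {0}) \<inter> X = {}"
  proof (rule ccontr)
    assume "(L - {0}) \<inter> X \<noteq> {}"
    then obtain u where u: "u \<in> L" "u \<noteq> 0" "u \<in> X" by auto
    have "fst u \<noteq> 0 \<Longrightarrow> int N \<le> \<bar>fst u\<bar>" "snd u \<noteq> 0 \<Longrightarrow> int N \<le> \<bar>snd u\<bar>"
      using u(1) dvd_imp_le_int[of "fst u" "int N"] dvd_imp_le_int[of "snd u" "int N"] by (auto simp: L_def)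
    moreover have "fst u \<noteq> 0 \<or> snd u \<noteq> 0" using u(2) by (auto simp: prod_eq_iff)
    ultimately show False using N_bound[OF u(3)] by auto
  qed
  then have small: "norm (infsum F (L - {0})) < norm (F 0)" by (rule X(2))
  have FS: "F summable_on A" for A
    by (rule abs_summable_summable, rule summable_on_subset[OF F]) simp
  have "infsum F L = F 0 + infsum F (L - {0})"
    by (subst L0, subst infsum_insert) (auto simp: FS)
  moreover have "infsum F L = 0"
  proof -
    have tw: "(\<lambda>u. F u * root_char N i j u) summable_on D" for i j
    proof (rule abs_summable_summable)
      show "(\<lambda>u. norm (F u * root_char N i j u)) summable_on D"
        by (simp add: norm_mult) (rule summable_on_subset[OF F], simp)
    qed
    have "0 = (\<Sum>i<N. \<Sum>j<N. infsum (\<lambda>u. F u * root_char N i j u) D)"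
      by (simp add: zero)
    also have "\<dots> = (\<Sum>\<^sub>\<infinity>u\<in>D. \<Sum>i<N. \<Sum>j<N. F u * root_char N i j u)"
      by (intro infsumI[symmetric] has_sum_finite_sum has_sum_infsum tw)
    also have "\<dots> = (\<Sum>\<^sub>\<infinity>u\<in>D. (of_nat N)\<^sup>2 * (if u \<in> L then F u else 0))"
    proof (rule infsum_cong)
      fix u assume "u \<in> D"
      have "(\<Sum>i<N. \<Sum>j<N. F u * root_char N i j u)
          = F u * ((\<Sum>i<N. exp (2 * pi * \<i> * of_int (fst u) * of_nat i / of_nat N))
              * (\<Sum>j<N. exp (2 * pi * \<i> * of_int (snd u) * of_nat j / of_nat N)))"
        unfolding root_char_def sum_product by (simp only: sum_distrib_left)
      then show "(\<Sum>i<N. \<Sum>j<N. F u * root_char N i j u) = (of_nat N)\<^sup>2 * (if u \<in> L then F u else 0)"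
        unfolding sum_roots_of_unity[OF N] using \<open>u \<in> D\<close> by (simp add: L_def power2_eq_square)
    qed
    also have "\<dots> = (of_nat N)\<^sup>2 * (\<Sum>\<^sub>\<infinity>u\<in>D. if u \<in> L then F u else 0)"
      by (rule infsum_cmult_right')
    also have "(\<Sum>\<^sub>\<infinity>u\<in>D. if u \<in> L then F u else 0) = infsum F L"
      by (rule infsum_cong_neutral) (auto simp: L_def)
    finally show ?thesis using N by simp
  qed
  ultimately have "norm (F 0) = norm (infsum F (L - {0}))"
    by (metis add_eq_0_iff norm_minus_cancel)
  then show False using small by simp
qed

section \<open>The binary theta series\<close>

lemma posdef_lower_bound:
  fixes P R T :: real
  assumes P: "P > 0" and disc: "R\<^sup>2 < 4 * P * T"
  obtains c where "c > 0" "\<And>x y. c * (x\<^sup>2 + y\<^sup>2) \<le> P * y\<^sup>2 + R * x * y + T * x\<^sup>2"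
proof
  have T: "T > 0"
  proof (rule ccontr)
    assume "\<not> T > 0"
    then have "4 * P * T \<le> 0" using P by (simp add: mult_nonneg_nonpos)
    then show False using disc zero_le_power2[of R] by linarith
  qed
  \<comment> \<open>The discriminant of the form minus \<open>c (x\<^sup>2 + y\<^sup>2)\<close> is then \<open>-4c\<^sup>2\<close>.\<close>
  define c where "c = (4 * P * T - R\<^sup>2) / (4 * (P + T))"
  show "c > 0" using disc P T by (simp add: c_def)
  fix x y :: real
  have cPT: "4 * c * (P + T) = 4 * P * T - R\<^sup>2" 
  proof -
    have nz: "4 * (P + T) \<noteq> 0" using P T by simp
    have "c * (4 * (P + T)) = 4 * P * T - R\<^sup>2"
      using nonzero_eq_divide_eq[OF nz, of c "4 * P * T - R\<^sup>2"] c_def by blast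
    then show ?thesis by (simp only: mult_ac)
  qed
  have "c * (P + T) \<le> P * T"
    using cPT zero_le_power2[of R] by linarith
  also have "\<dots> < P * (P + T)" using P by simp
  finally have cP: "P - c > 0" using P T by simp
  have "4 * (P - c) * (P * y\<^sup>2 + R * x * y + T * x\<^sup>2 - c * (x\<^sup>2 + y\<^sup>2))
      = (2 * (P - c) * y + R * x)\<^sup>2 + (4 * P * T - R\<^sup>2 - 4 * c * (P + T) + 4 * c\<^sup>2) * x\<^sup>2"
    by (simp add: power2_eq_square algebra_simps)
  also have "\<dots> \<ge> 0" unfolding cPT by simp
  finally have "0 \<le> P * y\<^sup>2 + R * x * y + T * x\<^sup>2 - c * (x\<^sup>2 + y\<^sup>2)"
    using cP by (simp add: zero_le_mult_iff)
  then show "c * (x\<^sup>2 + y\<^sup>2) \<le> P * y\<^sup>2 + R * x * y + T * x\<^sup>2" by simp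
qed

text \<open>
  The leading coefficient belongs to the second component, which is the one that carries the residue
  modulo \<open>d\<close>.
\<close>
definition binary_form :: "complex \<Rightarrow> complex \<Rightarrow> complex \<Rightarrow> int \<times> int \<Rightarrow> complex" where
  "binary_form A B C u = A * (of_int (snd u))\<^sup>2 + B * of_int (fst u) * of_int (snd u) + C * (of_int (fst u))\<^sup>2"

lemma binary_form_parallelogram:
  "binary_form A B C (u + v) + binary_form A B C (u - v) = 2 * (binary_form A B C u + binary_form A B C v)"
  by (simp add: binary_form_def power2_eq_square algebra_simps)

lemma binary_theta_abs_summable:
  assumes A: "Im A > 0" and disc: "(Im B)\<^sup>2 < 4 * Im A * Im C" and r: "r > 0"
  shows "(\<lambda>u. norm (exp (\<i> * of_real r * binary_form A B C u))) summable_on UNIV"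
proof -
  obtain c where c: "c > 0"
    and le: "\<And>x y. c * (x\<^sup>2 + y\<^sup>2) \<le> Im A * y\<^sup>2 + Im B * x * y + Im C * x\<^sup>2"
    using posdef_lower_bound[OF A disc] by blast
  let ?e = "\<lambda>n::int. complex_of_real (exp (- (r * c) * (of_int n)\<^sup>2 + 0 * \<bar>of_int n\<bar>))"
  have e: "(\<lambda>n. norm (?e n)) summable_on UNIV"
    using summable_gauss[of "r * c" 0] r c by simp
  have "(\<lambda>(m, n). norm (?e m * ?e n)) summable_on UNIV \<times> UNIV"
    by (rule abs_summable_prod[OF e e])
  then have "(\<lambda>u. norm (?e (fst u) * ?e (snd u))) summable_on UNIV"
    by (simp add: case_prod_unfold)
  then have "(\<lambda>u. norm (exp (\<i> * of_real r * binary_form A B C u))) summable_on (UNIV :: (int \<times> int) set)"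
  proof (rule Infinite_Sum.abs_summable_on_comparison_test')
    fix u :: "int \<times> int"
    define x y where "x = real_of_int (fst u)" and "y = real_of_int (snd u)"
    have "Im (binary_form A B C u) = Im A * y\<^sup>2 + Im B * x * y + Im C * x\<^sup>2"
      by (simp add: binary_form_def x_def y_def power2_eq_square)
    then have "r * (c * (x\<^sup>2 + y\<^sup>2)) \<le> r * Im (binary_form A B C u)"
      using le[of x y] r by simp
    then have "exp (- (r * Im (binary_form A B C u))) \<le> exp (- (r * c) * x\<^sup>2) * exp (- (r * c) * y\<^sup>2)"
      by (simp add: algebra_simps flip: exp_add)
    then show "norm (exp (\<i> * of_real r * binary_form A B C u)) \<le> norm (?e (fst u) * ?e (snd u))"
      by (simp add: norm_mult x_def y_def)
  qed
  then show ?thesis .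
qed

lemma infsum_parity_class:
  fixes f :: "int \<Rightarrow> complex"
  shows "infsum f {n. even (n - e)} = (\<Sum>\<^sub>\<infinity>k. f (2 * k + e))"
  by (rule infsum_reindex_bij_witness[where i = "\<lambda>k. 2 * k + e" and j = "\<lambda>n. (n - e) div 2"]) auto

text \<open>
  The hypothesis \<open>mixed\<close> matches the coefficient of \<open>m y\<close>, and \<open>pure\<close> that of \<open>y\<^sup>2\<close> up to a multiple of 16,
  when \<open>(m + 2y, \<delta>y)\<close> is substituted for \<open>(m, n)\<close>. The substitution preserves parities since \<open>\<delta>\<close> is
  odd, and parametrises the pairs with \<open>d | n\<close>. It leaves the coefficient of \<open>m\<^sup>2\<close> alone, so the two sums can be
  compared separately for each \<open>m\<close>.
\<close>
lemma critical_theta: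
  fixes l \<gamma> C0 :: complex and g C U \<delta> d :: int
  assumes l: "Re l > 0" "Im l > 0" and \<gamma>: "\<gamma>\<^sup>2 = of_int C" and C: "4 dvd g\<^sup>2 - C"
    and d: "d > 0" "odd d" and \<delta>: "\<delta> = d \<or> \<delta> = - d"
    and mixed: "of_int \<delta> * (of_int g + \<gamma> / l) + C0 = of_int g + \<gamma> * l"
    and pure: "(of_int \<delta>)\<^sup>2 * (1 - 1 / l\<^sup>2) + 8 * of_int \<delta> * (of_int g + \<gamma> / l) + 4 * C0
             = l\<^sup>2 - 1 + 16 * of_int U"
    and disc: "(Im (4 * (\<gamma> / l)))\<^sup>2 < 4 * Im (1 - 1 / l\<^sup>2) * Im C0"
  defines "E \<equiv> \<lambda>u. exp (\<i> * pi / 8 * binary_form (1 - 1 / l\<^sup>2) (4 * (of_int g + \<gamma> / l)) C0 u)"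
  shows "infsum E {t. same_parity s t} = l * infsum E {t. d dvd snd t \<and> same_parity s t}"
proof -
  define cls where "cls e = {n::int. even (n - e)}" for e
  define G where "G m = exp (\<i> * pi / 8 * (C0 * (of_int m)\<^sup>2))" for m :: int
  define S where "S b A m = (\<Sum>\<^sub>\<infinity>k::int. exp (\<i> * pi / 8 * (A * (of_int (2 * k + snd s))\<^sup>2
              + 4 * (of_int m * b) * of_int (2 * k + snd s))))" for b A and m :: int
  have E: "E summable_on X" for X
  proof -
    have "Im (1 - 1 / l\<^sup>2) > 0" by (rule Im_one_minus_inverse_square[OF l])
    then have "(\<lambda>u. norm (exp (\<i> * of_real (pi / 8) * binary_form (1 - 1 / l\<^sup>2) (4 * (of_int g + \<gamma> / l)) C0 u))) summable_on UNIV"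
      using disc by (intro binary_theta_abs_summable) simp_all
    then have "E summable_on UNIV"
      unfolding E_def by (simp add: abs_summable_summable)
    then show ?thesis by (rule summable_on_subset) simp
  qed
  have classes: "{t. same_parity s t} = cls (fst s) \<times> cls (snd s)"
    by (auto simp: same_parity_def cls_def)
  have left: "(\<Sum>\<^sub>\<infinity>n\<in>cls (snd s). E (m, n)) = G m * S (of_int g + \<gamma> / l) (1 - 1 / l\<^sup>2) m" for m
  proof -
    have "E (m, n) = G m * exp (\<i> * pi / 8 * ((1 - 1 / l\<^sup>2) * (of_int n)\<^sup>2
        + 4 * (of_int m * (of_int g + \<gamma> / l)) * of_int n))" for n
    proof -
      have "\<i> * pi / 8 * (A * y\<^sup>2 + 4 * b * x * y + C0 * x\<^sup>2)
          = \<i> * pi / 8 * (C0 * x\<^sup>2) + \<i> * pi / 8 * (A * y\<^sup>2 + 4 * (x * b) * y)" for A b x y :: complex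
        by (simp add: algebra_simps)
      then show ?thesis
        by (simp only: E_def G_def binary_form_def fst_conv snd_conv exp_add)
    qed
    then show ?thesis
      by (simp only: cls_def infsum_parity_class S_def infsum_cmult_right')
  qed
  have scaled: "E (m + 2 * y, \<delta> * y)
      = G m * exp (\<i> * pi / 8 * ((l\<^sup>2 - 1) * (of_int y)\<^sup>2 + 4 * (of_int m * (of_int g + \<gamma> * l)) * of_int y))" for m y
  proof -
    let ?b = "of_int g + \<gamma> / l"
    have "binary_form (1 - 1 / l\<^sup>2) (4 * ?b) C0 (m + 2 * y, \<delta> * y)
        = ((of_int \<delta>)\<^sup>2 * (1 - 1 / l\<^sup>2) + 8 * of_int \<delta> * ?b + 4 * C0) * (of_int y)\<^sup>2
          + 4 * (of_int \<delta> * ?b + C0) * of_int m * of_int y + C0 * (of_int m)\<^sup>2"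
      by (simp add: binary_form_def power2_eq_square algebra_simps)
    also have "\<dots> = C0 * (of_int m)\<^sup>2
        + ((l\<^sup>2 - 1) * (of_int y)\<^sup>2 + 4 * (of_int m * (of_int g + \<gamma> * l)) * of_int y)
        + 16 * of_int (U * y\<^sup>2)"
      unfolding mixed pure by (simp add: algebra_simps)
    finally have form: "binary_form (1 - 1 / l\<^sup>2) (4 * ?b) C0 (m + 2 * y, \<delta> * y) = \<dots>" .
    have "\<i> * pi / 8 * (X + Y + 16 * Z) = \<i> * pi / 8 * X + \<i> * pi / 8 * Y + 2 * pi * \<i> * Z" for X Y Z :: complex
      by (simp add: algebra_simps)
    then show ?thesis
      by (simp only: E_def G_def form exp_add exp_2pi_int mult_1_right)
  qed
  have right: "(\<Sum>\<^sub>\<infinity>y\<in>cls (snd s). E (m + 2 * y, \<delta> * y)) = G m * S (of_int g + \<gamma> * l) (l\<^sup>2 - 1) m" for m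
    unfolding scaled cls_def infsum_parity_class S_def infsum_cmult_right'[symmetric] ..
  have transfer: "S (of_int g + \<gamma> / l) (1 - 1 / l\<^sup>2) m = l * S (of_int g + \<gamma> * l) (l\<^sup>2 - 1) m" for m
    unfolding S_def by (rule theta_class_transfer[OF l \<gamma> C])
  have bij: "bij_betw (\<lambda>(m, y). (m + 2 * y, \<delta> * y)) (cls (fst s) \<times> cls (snd s)) {t. d dvd snd t \<and> same_parity s t}"
  proof (rule bij_betw_byWitness[where f' = "\<lambda>(m, n). (m - 2 * (n div \<delta>), n div \<delta>)"])
    have \<delta>0: "\<delta> \<noteq> 0" "odd \<delta>" and dvd: "d dvd n \<longleftrightarrow> \<delta> dvd n" for n
      using d \<delta> by auto
    show "\<forall>a\<in>cls (fst s) \<times> cls (snd s).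
        (\<lambda>(m, n). (m - 2 * (n div \<delta>), n div \<delta>)) ((\<lambda>(m, y). (m + 2 * y, \<delta> * y)) a) = a"
      using \<delta>0 by auto
    show "\<forall>t\<in>{t. d dvd snd t \<and> same_parity s t}.
        (\<lambda>(m, y). (m + 2 * y, \<delta> * y)) ((\<lambda>(m, n). (m - 2 * (n div \<delta>), n div \<delta>)) t) = t"
      by (auto simp: dvd)
    show "(\<lambda>(m, y). (m + 2 * y, \<delta> * y)) ` (cls (fst s) \<times> cls (snd s)) \<subseteq> {t. d dvd snd t \<and> same_parity s t}"
      using \<delta>0 by (auto simp: dvd cls_def same_parity_def)
    show "(\<lambda>(m, n). (m - 2 * (n div \<delta>), n div \<delta>)) ` {t. d dvd snd t \<and> same_parity s t}
        \<subseteq> cls (fst s) \<times> cls (snd s)"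
    proof (rule image_subsetI)
      fix t :: "int \<times> int" assume t: "t \<in> {t. d dvd snd t \<and> same_parity s t}"
      then obtain k where k: "snd t = \<delta> * k" by (auto simp: dvd)
      then have "snd t div \<delta> = k" "even (k - snd s)"
        using t \<delta>0 by (auto simp: same_parity_def)
      then show "(case t of (m, n) \<Rightarrow> (m - 2 * (n div \<delta>), n div \<delta>)) \<in> cls (fst s) \<times> cls (snd s)"
        using t by (auto simp: cls_def same_parity_def case_prod_unfold)
    qed
  qed
  have "infsum E {t. d dvd snd t \<and> same_parity s t}
      = infsum (\<lambda>z. E ((\<lambda>(m, y). (m + 2 * y, \<delta> * y)) z)) (cls (fst s) \<times> cls (snd s))"
    by (rule infsum_reindex_bij_betw[OF bij, symmetric])
  also have "\<dots> = (\<Sum>\<^sub>\<infinity>m\<in>cls (fst s). \<Sum>\<^sub>\<infinity>y\<in>cls (snd s). E (m + 2 * y, \<delta> * y))"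
  proof -
    have "(\<lambda>z. E ((\<lambda>(m, y). (m + 2 * y, \<delta> * y)) z)) summable_on cls (fst s) \<times> cls (snd s)"
      using summable_on_reindex_bij_betw[OF bij, of E] E by blast
    from infsum_Sigma_banach[OF this] show ?thesis by simp
  qed
  finally have R: "infsum E {t. d dvd snd t \<and> same_parity s t}
      = (\<Sum>\<^sub>\<infinity>m\<in>cls (fst s). G m * S (of_int g + \<gamma> * l) (l\<^sup>2 - 1) m)"
    by (simp only: right)
  have "infsum E {t. same_parity s t} = (\<Sum>\<^sub>\<infinity>m\<in>cls (fst s). \<Sum>\<^sub>\<infinity>n\<in>cls (snd s). E (m, n))"
    unfolding classes by (rule infsum_Sigma_banach[symmetric]) (rule E)
  also have "\<dots> = (\<Sum>\<^sub>\<infinity>m\<in>cls (fst s). l * (G m * S (of_int g + \<gamma> * l) (l\<^sup>2 - 1) m))"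
    by (simp only: left transfer mult_ac)
  also have "\<dots> = l * infsum E {t. d dvd snd t \<and> same_parity s t}"
    unfolding R by (rule infsum_cmult_right')
  finally show ?thesis .
qed

section \<open>Critical values\<close>

lemma critical_valueI:
  fixes f :: "int \<Rightarrow> complex"
  assumes d: "d > 1"
    and period: "\<And>x. f (x mod int d) = f x"
    and nonzero: "f k0 \<noteq> 0"
    and crit: "\<And>k. (\<Sum>j\<in>{0..int d - 1}. f (k + j) * f (k - j)) = z * (f k)\<^sup>2"
  shows "critical_value d z"
proof -
  define R where "R = residue_ring (int d)"
  interpret residues "int d" R
    using d by unfold_locales (simp_all add: R_def)
  have minus: "k \<ominus>\<^bsub>R\<^esub> j = (k - j) mod int d" for k j
    by (simp add: a_minus_def res_neg_eq res_add_eq mod_simps)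
  show ?thesis
    unfolding critical_value_def Let_def R_def[symmetric]
  proof (intro exI conjI ballI)
    show "\<exists>k\<in>carrier R. f k \<noteq> 0"
      using nonzero period[of k0] mod_in_carrier[of k0] by metis
    show "(\<Sum>l\<in>carrier R. f (k \<oplus>\<^bsub>R\<^esub> l) * f (k \<ominus>\<^bsub>R\<^esub> l)) = z * (f k)\<^sup>2" for k
      unfolding res_add_eq minus period res_carrier_eq by (rule crit)
  qed
qed

lemma critical_value_theta:
  fixes l \<gamma> C0 :: complex and g C U \<delta> :: int
  assumes l: "Re l > 0" "Im l > 0" and \<gamma>: "\<gamma>\<^sup>2 = of_int C" and C: "4 dvd g\<^sup>2 - C"
    and d: "d > 1" "odd d" and \<delta>: "\<delta> = int d \<or> \<delta> = - int d"
    and mixed: "of_int \<delta> * (of_int g + \<gamma> / l) + C0 = of_int g + \<gamma> * l"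
    and pure: "(of_int \<delta>)\<^sup>2 * (1 - 1 / l\<^sup>2) + 8 * of_int \<delta> * (of_int g + \<gamma> / l) + 4 * C0
             = l\<^sup>2 - 1 + 16 * of_int U"
    and disc: "(Im (4 * (\<gamma> / l)))\<^sup>2 < 4 * Im (1 - 1 / l\<^sup>2) * Im C0"
  shows "critical_value d l"
proof -
  define F where "F = binary_form (1 - 1 / l\<^sup>2) (4 * (of_int g + \<gamma> / l)) C0"
  define E where "E u = exp (\<i> * pi / 8 * F u)" for u
  define Q where "Q u = exp (\<i> * of_real (pi / 4) * F u)" for u
  have Q: "(\<lambda>u. norm (Q u)) summable_on UNIV"
    unfolding Q_def F_def using disc Im_one_minus_inverse_square[OF l]
    by (intro binary_theta_abs_summable) simp_all
  have "Q 0 \<noteq> 0" by (simp add: Q_def)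
  then obtain N i j where nonzero: "infsum (\<lambda>u. Q u * root_char N i j u) {u. int d dvd snd u} \<noteq> 0"
    using exists_nonvanishing_twist[OF Q, of "{u. int d dvd snd u}"] by auto
  define h where "h u = Q u * root_char N i j u" for u
  define f where "f k = infsum h {u. int d dvd (snd u - k)}" for k
  show ?thesis
  proof (rule critical_valueI[OF d(1)])
    show "f (x mod int d) = f x" for x
    proof -
      have "int d dvd (y - x mod int d) \<longleftrightarrow> int d dvd (y - x)" for y
        by (simp add: mod_eq_dvd_iff[symmetric] mod_simps)
      then show ?thesis by (simp add: f_def)
    qed
    show "f 0 \<noteq> 0"
      using nonzero by (simp add: f_def h_def[abs_def])
    show "(\<Sum>j\<in>{0..int d - 1}. f (k + j) * f (k - j)) = l * (f k)\<^sup>2" for k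
      unfolding f_def
    proof (rule lattice_criterion)
      show "(\<lambda>u. norm (h u)) summable_on UNIV"
        using Q by (simp add: h_def norm_mult)
      show "h u * h v = (E (u + v) * root_char N i j (u + v)) * E (u - v)" for u v
      proof -
        have "\<i> * of_real (pi / 4) * F u + \<i> * of_real (pi / 4) * F v
            = \<i> * pi / 8 * (2 * (F u + F v))"
          by (simp add: algebra_simps)
        also have "\<dots> = \<i> * pi / 8 * F (u + v) + \<i> * pi / 8 * F (u - v)"
          unfolding F_def binary_form_parallelogram[symmetric] by (simp add: algebra_simps)
        finally have "Q u * Q v = E (u + v) * E (u - v)"
          unfolding Q_def E_def by (simp only: flip: exp_add)
        then show ?thesis
          unfolding h_def root_char_add by (simp add: mult_ac)
      qed
      show "infsum E {t. same_parity s t} = l * infsum E {t. int d dvd snd t \<and> same_parity s t}" for s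
        unfolding E_def F_def
        by (rule critical_theta[OF l \<gamma> C _ _ \<delta> mixed pure disc]) (use d in auto)
    qed (use d in auto)
  qed
qed

text \<open>
  The two relations on \<open>l\<close> and \<open>l'\<close> are what makes \<open>mixed\<close> and \<open>pure\<close> solvable. The value of \<open>C0\<close> is
  forced by \<open>mixed\<close> and \<open>\<delta>/l = l'\<close>. In \<open>pure\<close>, everything but integers then combines to
  \<open>(l + l')\<^sup>2 - 4 \<gamma> (l + l')\<close>, which equals \<open>4 (\<alpha>\<^sup>2 - \<gamma>\<^sup>2)\<close>.
\<close>
lemma critical_value_from_sum:
  fixes l l' \<alpha> \<gamma> :: complex and g A C U \<delta> :: int
  assumes l: "Re l > 0" "Im l > 0" and \<gamma>: "\<gamma>\<^sup>2 = of_int C" and \<alpha>: "\<alpha>\<^sup>2 = of_int A"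
    and C: "4 dvd g\<^sup>2 - C" and U: "16 dvd (1 + \<delta>) * (1 + \<delta> + 4 * g) - 4 * (A - C)"
    and d: "d > 1" "odd d" and \<delta>: "\<delta> = int d \<or> \<delta> = - int d"
    and ll: "l * l' = of_int \<delta>" and sum: "l + l' = 2 * (\<alpha> + \<gamma>)"
    and disc: "(Im (4 * (\<gamma> / l)))\<^sup>2 < 4 * Im (1 - 1 / l\<^sup>2) * Im (\<gamma> * (l - l'))"
  shows "critical_value d l"
proof -
  obtain U where U: "(1 + \<delta>) * (1 + \<delta> + 4 * g) - 4 * (A - C) = 16 * U" using U ..
  have U': "(1 + of_int \<delta>) * (1 + of_int \<delta> + 4 * of_int g) - 4 * (\<alpha>\<^sup>2 - \<gamma>\<^sup>2) = 16 * complex_of_int U"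
    using arg_cong[OF U, of complex_of_int] by (simp add: \<alpha> \<gamma>)
  define C0 where "C0 = of_int g * (1 - of_int \<delta>) + \<gamma> * (l - l')"
  have l0: "l \<noteq> 0" using l by auto
  have inv: "of_int \<delta> * (\<gamma> / l) = \<gamma> * l'"
    using l0 by (simp flip: ll)
  have inv2: "(of_int \<delta>)\<^sup>2 * (1 - 1 / l\<^sup>2) = (of_int \<delta>)\<^sup>2 - l'\<^sup>2"
    using l0 by (simp add: power_mult_distrib right_diff_distrib flip: ll)
  show ?thesis
  proof (rule critical_value_theta[OF l \<gamma> C d \<delta>])
    show "of_int \<delta> * (of_int g + \<gamma> / l) + C0 = of_int g + \<gamma> * l"
      unfolding distrib_left inv C0_def by (simp add: algebra_simps)
    show "(of_int \<delta>)\<^sup>2 * (1 - 1 / l\<^sup>2) + 8 * of_int \<delta> * (of_int g + \<gamma> / l) + 4 * C0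
        = l\<^sup>2 - 1 + 16 * of_int U"
    proof -
      have "(l + l')\<^sup>2 - 4 * \<gamma> * (l + l') = 4 * (\<alpha>\<^sup>2 - \<gamma>\<^sup>2)"
        unfolding sum by (simp add: power2_eq_square algebra_simps)
      then have sq: "l\<^sup>2 + l'\<^sup>2 + 2 * of_int \<delta> - 4 * \<gamma> * (l + l') = 4 * (\<alpha>\<^sup>2 - \<gamma>\<^sup>2)"
        by (simp add: power2_sum mult.assoc flip: ll)
      have "8 * of_int \<delta> * (of_int g + \<gamma> / l) = 8 * of_int \<delta> * of_int g + 8 * (\<gamma> * l')"
        unfolding inv[symmetric] by (simp add: algebra_simps)
      then have "(of_int \<delta>)\<^sup>2 * (1 - 1 / l\<^sup>2) + 8 * of_int \<delta> * (of_int g + \<gamma> / l) + 4 * C0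
          = l\<^sup>2 - 1 + ((1 + of_int \<delta>) * (1 + of_int \<delta> + 4 * of_int g)
            - (l\<^sup>2 + l'\<^sup>2 + 2 * of_int \<delta> - 4 * \<gamma> * (l + l')))"
        unfolding inv2 C0_def by (simp add: power2_eq_square algebra_simps)
      then show ?thesis unfolding sq U' .
    qed
    have "Im C0 = Im (\<gamma> * (l - l'))"
      by (simp add: C0_def)
    then show "(Im (4 * (\<gamma> / l)))\<^sup>2 < 4 * Im (1 - 1 / l\<^sup>2) * Im C0"
      using disc by simp
  qed
qed

text \<open>
  The imaginary part of the binary form belonging to a critical value has the coefficients \<open>2\<rho>\<kappa>/D\<^sup>2\<close>,
  \<open>\<plusminus>4q\<kappa>/D\<close> and \<open>2q\<kappa>\<close>, with \<open>q = \<surd>c\<close> and \<open>\<rho> = \<surd>a + \<surd>c\<close>; this is its positive definiteness.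
\<close>
lemma discriminant_negative:
  fixes q \<rho> \<kappa> D :: real
  assumes "q > 0" "\<rho> > q" "\<kappa> > 0" "D > 0"
  shows "(4 * (q * \<kappa> / D))\<^sup>2 < 4 * (2 * \<rho> * \<kappa> / D\<^sup>2) * (2 * q * \<kappa>)"
proof -
  have "(4 * (q * \<kappa> / D))\<^sup>2 = q * (16 * q * (\<kappa> / D)\<^sup>2)"
    by (simp add: power2_eq_square)
  also have "\<dots> < \<rho> * (16 * q * (\<kappa> / D)\<^sup>2)"
    using assms by (intro mult_strict_right_mono) auto
  also have "\<dots> = 4 * (2 * \<rho> * \<kappa> / D\<^sup>2) * (2 * q * \<kappa>)"
    by (simp add: power2_eq_square)
  finally show ?thesis .
qed

lemma critical_value_real_roots:
  fixes q p \<kappa> :: real and g :: int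
  assumes q: "q > 0" "q\<^sup>2 = of_nat c" and p: "p > 0" "p\<^sup>2 = of_nat a" and \<kappa>: "\<kappa> > 0"
    and D: "(p + q)\<^sup>2 + \<kappa>\<^sup>2 = real d" and d: "d > 1" "odd d"
    and C: "4 dvd g\<^sup>2 - int c" and U: "16 dvd (1 + int d) * (1 + int d + 4 * g) - 4 * (int a - int c)"
  shows "critical_value d (Complex (p + q) \<kappa>)"
proof (rule critical_value_from_sum[where l' = "Complex (p + q) (- \<kappa>)" and \<alpha> = "of_real p" and \<gamma> = "of_real q"])
  have Dpos: "real d > 0" using d by simp
  show "(complex_of_real q)\<^sup>2 = of_int (int c)" "(complex_of_real p)\<^sup>2 = of_int (int a)"
    using q p by (simp_all flip: of_real_power)
  show "Complex (p + q) \<kappa> * Complex (p + q) (- \<kappa>) = of_int (int d)"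
    using D by (simp add: complex_eq_iff power2_eq_square)
  have 1: "Im (4 * (complex_of_real q / Complex (p + q) \<kappa>)) = - (4 * (q * \<kappa> / real d))"
    using D by (simp add: Im_divide)
  have 2: "Im (1 - 1 / (Complex (p + q) \<kappa>)\<^sup>2) = 2 * (p + q) * \<kappa> / (real d)\<^sup>2"
  proof -
    have "norm ((Complex (p + q) \<kappa>)\<^sup>2) = real d"
      by (simp add: norm_power cmod_power2 D)
    then show ?thesis
      by (simp add: Im_divide flip: cmod_power2) (simp add: power2_eq_square)
  qed
  have 3: "Im (complex_of_real q * (Complex (p + q) \<kappa> - Complex (p + q) (- \<kappa>))) = 2 * q * \<kappa>"
    by simp
  show "(Im (4 * (complex_of_real q / Complex (p + q) \<kappa>)))\<^sup>2 < 4 * Im (1 - 1 / (Complex (p + q) \<kappa>)\<^sup>2) *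
      Im (complex_of_real q * (Complex (p + q) \<kappa> - Complex (p + q) (- \<kappa>)))"
    unfolding 1 2 3 power2_minus by (rule discriminant_negative) (use q p \<kappa> Dpos in auto)
qed (use assms in \<open>auto simp: complex_eq_iff\<close>)

text \<open>
  The same construction with \<open>\<surd>a\<close>, \<open>\<surd>c\<close> and \<open>d\<close> replaced by \<open>\<i>\<surd>a\<close>, \<open>\<i>\<surd>c\<close> and \<open>-d\<close>. The sign
  of \<open>\<delta>\<close> is what keeps the imaginary part of the form positive definite.
\<close>
lemma critical_value_imaginary_roots:
  fixes q p \<kappa> :: real and g :: int
  assumes q: "q > 0" "q\<^sup>2 = of_nat c" and p: "p > 0" "p\<^sup>2 = of_nat a" and \<kappa>: "\<kappa> > 0"
    and D: "(p + q)\<^sup>2 + \<kappa>\<^sup>2 = real d" and d: "d > 1" "odd d"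
    and C: "4 dvd g\<^sup>2 + int c" and U: "16 dvd (1 - int d) * (1 - int d + 4 * g) + 4 * (int a - int c)"
  shows "critical_value d (Complex \<kappa> (p + q))"
proof (rule critical_value_from_sum[where l' = "Complex (- \<kappa>) (p + q)" and \<alpha> = "\<i> * of_real p" and \<gamma> = "\<i> * of_real q"
      and \<delta> = "- int d" and A = "- int a" and C = "- int c" and g = g])
  have Dpos: "real d > 0" using d by simp
  show "(\<i> * complex_of_real q)\<^sup>2 = of_int (- int c)" "(\<i> * complex_of_real p)\<^sup>2 = of_int (- int a)"
    using q p by (simp_all add: power_mult_distrib flip: of_real_power)
  show "Complex \<kappa> (p + q) * Complex (- \<kappa>) (p + q) = of_int (- int d)"
    using D by (simp add: complex_eq_iff power2_eq_square)
  have 1: "Im (4 * (\<i> * complex_of_real q / Complex \<kappa> (p + q))) = 4 * (q * \<kappa> / real d)"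
    using D by (simp add: Im_divide add.commute)
  have 2: "Im (1 - 1 / (Complex \<kappa> (p + q))\<^sup>2) = 2 * (p + q) * \<kappa> / (real d)\<^sup>2"
  proof -
    have "norm ((Complex \<kappa> (p + q))\<^sup>2) = real d"
      using D by (simp add: norm_power cmod_power2 add.commute)
    then show ?thesis
      by (simp add: Im_divide flip: cmod_power2) (simp add: power2_eq_square)
  qed
  have 3: "Im (\<i> * complex_of_real q * (Complex \<kappa> (p + q) - Complex (- \<kappa>) (p + q))) = 2 * q * \<kappa>"
    by simp
  show "(Im (4 * (\<i> * complex_of_real q / Complex \<kappa> (p + q))))\<^sup>2 < 4 * Im (1 - 1 / (Complex \<kappa> (p + q))\<^sup>2) *
      Im (\<i> * complex_of_real q * (Complex \<kappa> (p + q) - Complex (- \<kappa>) (p + q)))"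
    unfolding 1 2 3 by (rule discriminant_negative) (use q p \<kappa> Dpos in auto)
  have "(1 + - int d) * (1 + - int d + 4 * g) - 4 * (- int a - - int c)
      = (1 - int d) * (1 - int d + 4 * g) + 4 * (int a - int c)" by simp
  then show "16 dvd (1 + - int d) * (1 + - int d + 4 * g) - 4 * (- int a - - int c)"
    using U by (simp only:)
qed (use assms in \<open>auto simp: complex_eq_iff\<close>)

lemma cong_4_witness:
  fixes n r :: nat
  assumes "[n = r] (mod 4)" and "r < 4"
  shows "\<exists>x. n = 4 * x + r"
proof
  have "n mod 4 = r" using assms by (simp add: unique_euclidean_semiring_class.cong_def)
  then show "n = 4 * (n div 4) + r" using mult_div_mod_eq[of 4 n] by simp
qed

theorem proposition6p5:
  fixes a b c d :: nat
  assumes "a > 0" and "b > 0" and "c > 0"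
    and "d = a + b + c"
    and "(int b)\<^sup>2 - 4 * int a * int c > 0"
  shows "([a = 1] (mod 4) \<and>
          ([b = 0] (mod 4) \<and> [c = 0] (mod 4) \<or> [b = 1] (mod 4) \<and> [c = 1] (mod 4)) \<longrightarrow>
          critical_value d
            (complex_of_real (sqrt (real a)) + complex_of_real (sqrt (real c))
              + \<i> * complex_of_real (sqrt (real b - 2 * sqrt (real a * real c))))) \<and>
         ([a = 3] (mod 4) \<and>
          ([b = 0] (mod 4) \<and> [c = 0] (mod 4) \<or> [b = 3] (mod 4) \<and> [c = 3] (mod 4)) \<longrightarrow>
          critical_value d
            (complex_of_real (sqrt (real b - 2 * sqrt (real a * real c)))
              + \<i> * complex_of_real (sqrt (real a)) + \<i> * complex_of_real (sqrt (real c))))"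
proof (intro conjI impI)
  define p q \<kappa> where "p = sqrt (real a)" and "q = sqrt (real c)"
    and "\<kappa> = sqrt (real b - 2 * sqrt (real a * real c))"
  have p: "p > 0" "p\<^sup>2 = of_nat a" and q: "q > 0" "q\<^sup>2 = of_nat c"
    using assms by (simp_all add: p_def q_def)
  have pq: "sqrt (real a * real c) = p * q" by (simp add: p_def q_def real_sqrt_mult)
  have "real_of_int (4 * int a * int c) < real_of_int ((int b)\<^sup>2)"
    using assms(5) by (simp only: of_int_less_iff)
  then have "(2 * (p * q))\<^sup>2 < (real b)\<^sup>2"
    using p q by (simp add: power_mult_distrib)
  then have gap: "2 * (p * q) < real b"
    by (rule power2_less_imp_less) simp
  then have \<kappa>: "\<kappa> > 0" and \<kappa>2: "\<kappa>\<^sup>2 = real b - 2 * (p * q)"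
    unfolding \<kappa>_def pq by simp_all
  have D: "(p + q)\<^sup>2 + \<kappa>\<^sup>2 = real d"
    using p q assms(4) by (simp add: power2_sum \<kappa>2)
  have d1: "d > 1" using assms by simp
  {
    assume A: "[a = 1] (mod 4) \<and> ([b = 0] (mod 4) \<and> [c = 0] (mod 4) \<or> [b = 1] (mod 4) \<and> [c = 1] (mod 4))"
    have "\<exists>x. a = 4 * x + 1"
      by (rule cong_4_witness) (use A in auto)
    then obtain x where x: "a = 4 * x + 1" ..
    consider "[b = 0] (mod 4)" "[c = 0] (mod 4)" | "[b = 1] (mod 4)" "[c = 1] (mod 4)"
      using A by blast
    then have "critical_value d (Complex (p + q) \<kappa>)"
    proof cases
      case 1
      obtain y z where yz: "b = 4 * y + 0" "c = 4 * z + 0"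
        using cong_4_witness[OF 1(1)] cong_4_witness[OF 1(2)] by auto
      have d4: "d = 4 * (x + y + z) + 1" using assms(4) x yz by simp
      show ?thesis
      proof (rule critical_value_real_roots[OF q p \<kappa> D d1, where g = 0])
        define w where "w = int x + int y + int z"
        have "(1 + int d) * (1 + int d + 4 * 0) - 4 * (int a - int c) = 16 * (w + w * w - int x + int z)"
          by (simp add: d4 x yz w_def algebra_simps)
        then show "16 dvd (1 + int d) * (1 + int d + 4 * 0) - 4 * (int a - int c)" by (simp only: dvd_triv_left)
      qed (simp_all add: d4 yz)
    next
      case 2
      obtain y z where yz: "b = 4 * y + 1" "c = 4 * z + 1"
        using cong_4_witness[OF 2(1)] cong_4_witness[OF 2(2)] by auto
      have d4: "d = 4 * (x + y + z) + 3" using assms(4) x yz by simp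
      show ?thesis
      proof (rule critical_value_real_roots[OF q p \<kappa> D d1, where g = 1])
        define w where "w = int x + int y + int z"
        have "(1 + int d) * (1 + int d + 4 * 1) - 4 * (int a - int c) = 16 * ((1 + w) * (2 + w) - int x + int z)"
          by (simp add: d4 x yz w_def algebra_simps)
        then show "16 dvd (1 + int d) * (1 + int d + 4 * 1) - 4 * (int a - int c)" by (simp only: dvd_triv_left)
      qed (simp_all add: d4 yz)
    qed
    moreover have "Complex (p + q) \<kappa> = complex_of_real p + complex_of_real q + \<i> * complex_of_real \<kappa>"
      by (simp add: complex_eq_iff)
    ultimately show "critical_value d
            (complex_of_real (sqrt (real a)) + complex_of_real (sqrt (real c))
              + \<i> * complex_of_real (sqrt (real b - 2 * sqrt (real a * real c))))"
      by (simp add: p_def q_def \<kappa>_def)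
  next
    assume A: "[a = 3] (mod 4) \<and> ([b = 0] (mod 4) \<and> [c = 0] (mod 4) \<or> [b = 3] (mod 4) \<and> [c = 3] (mod 4))"
    have "\<exists>x. a = 4 * x + 3"
      by (rule cong_4_witness) (use A in auto)
    then obtain x where x: "a = 4 * x + 3" ..
    consider "[b = 0] (mod 4)" "[c = 0] (mod 4)" | "[b = 3] (mod 4)" "[c = 3] (mod 4)"
      using A by blast
    then have "critical_value d (Complex \<kappa> (p + q))"
    proof cases
      case 1
      obtain y z where yz: "b = 4 * y + 0" "c = 4 * z + 0"
        using cong_4_witness[OF 1(1)] cong_4_witness[OF 1(2)] by auto
      have d4: "d = 4 * (x + y + z) + 3" using assms(4) x yz by simp
      show ?thesis
      proof (rule critical_value_imaginary_roots[OF q p \<kappa> D d1, where g = 0])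
        define w where "w = int x + int y + int z"
        have "(1 - int d) * (1 - int d + 4 * 0) + 4 * (int a - int c) = 16 * (1 + w + w * w + int x - int z)"
          by (simp add: d4 x yz w_def algebra_simps)
        then show "16 dvd (1 - int d) * (1 - int d + 4 * 0) + 4 * (int a - int c)" by (simp only: dvd_triv_left)
      qed (simp_all add: d4 yz)
    next
      case 2
      obtain y z where yz: "b = 4 * y + 3" "c = 4 * z + 3"
        using cong_4_witness[OF 2(1)] cong_4_witness[OF 2(2)] by auto
      have d4: "d = 4 * (x + y + z) + 9" using assms(4) x yz by simp
      show ?thesis
      proof (rule critical_value_imaginary_roots[OF q p \<kappa> D d1, where g = 1])
        define w where "w = int x + int y + int z"
        have "(1 - int d) * (1 - int d + 4 * 1) + 4 * (int a - int c) = 16 * ((2 + w) * (1 + w) + int x - int z)"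
          by (simp add: d4 x yz w_def algebra_simps)
        then show "16 dvd (1 - int d) * (1 - int d + 4 * 1) + 4 * (int a - int c)" by (simp only: dvd_triv_left)
      qed (simp_all add: d4 yz)
    qed
    moreover have "Complex \<kappa> (p + q) = complex_of_real \<kappa> + \<i> * complex_of_real p + \<i> * complex_of_real q"
      by (simp add: complex_eq_iff)
    ultimately show "critical_value d
            (complex_of_real (sqrt (real b - 2 * sqrt (real a * real c)))
              + \<i> * complex_of_real (sqrt (real a)) + \<i> * complex_of_real (sqrt (real c)))"
      by (simp add: p_def q_def \<kappa>_def)
  }
qed

end
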